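(* Let $D$ be a non-commutative locally finite division ring with center $F$. If $N$ is a normal subgroup of the multiplicative group $D^*$ and $N$ is radical over some proper division subring of $D$, then $N\subseteq F$.
   Context: $D^*=D\setminus\{0\}$ is the multiplicative group of $D$. A division ring $D$ with center $F$ is locally finite if for every finite subset $S$ of $D$, the division subring $F(S)$ of $D$ generated by $F$ and $S$ is a finite dimensional vector space over $F$. An element $x\in D$ is radical over a subring $K$ of $D$ if there is a positive integer $n_x$ (depending on $x$) such that $x^{n_x}\in K$; a subset of $D$ is radical over $K$ if all its elements are. *)

theory Defs
  imports Complex_Main "HOL.Hull" "HOL-Algebra.Coset"
begin

definition ring_center :: "'a::division_ring set" where
  "ring_center = {z. \<forall>x. z * x = x * z}"

text \<open>The center is also provided as a field type, so that the library theory of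
  vector spaces applies to a division ring over its center.\<close>

typedef (overloaded) 'a center = "ring_center :: 'a::division_ring set"
  morphisms of_center to_center
  by (rule exI[of _ 0]) (simp add: ring_center_def)

setup_lifting type_definition_center

lemma ring_center_inverse:
  fixes z :: "'a::division_ring"
  assumes "z \<in> ring_center"
  shows "inverse z \<in> ring_center"
proof (cases "z = 0")
  case False
  have "inverse z * x = x * inverse z" for x
  proof -
    have "inverse z * x = inverse z * (x * z) * inverse z"
      using False by (simp add: mult.assoc)
    also have "x * z = z * x"
      using assms by (simp add: ring_center_def)
    also have "inverse z * (z * x) * inverse z = x * inverse z"
      using False by (simp add: mult.assoc[symmetric])
    finally show ?thesis .
  qed
  then show ?thesis by (simp add: ring_center_def)
qed (use assms in simp)

lemma ring_center_mult:
  fixes y z :: "'a::division_ring"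
  assumes "y \<in> ring_center" "z \<in> ring_center"
  shows "y * z \<in> ring_center"
proof -
  have "y * z * x = x * (y * z)" for x
  proof -
    have "y * z * x = y * (x * z)"
      using assms(2) by (simp add: ring_center_def mult.assoc)
    also have "\<dots> = x * y * z"
      using assms(1) by (simp add: ring_center_def mult.assoc[symmetric])
    finally show ?thesis by (simp add: mult.assoc)
  qed
  then show ?thesis by (simp add: ring_center_def)
qed

instantiation center :: (division_ring) field
begin

lift_definition zero_center :: "'a center" is 0 by (simp add: ring_center_def)
lift_definition one_center :: "'a center" is 1 by (simp add: ring_center_def)
lift_definition plus_center :: "'a center \<Rightarrow> 'a center \<Rightarrow> 'a center" is "(+)"
  by (simp add: ring_center_def distrib_left distrib_right)
lift_definition minus_center :: "'a center \<Rightarrow> 'a center \<Rightarrow> 'a center" is "(-)"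
  by (simp add: ring_center_def left_diff_distrib right_diff_distrib)
lift_definition uminus_center :: "'a center \<Rightarrow> 'a center" is uminus
  by (simp add: ring_center_def)
lift_definition times_center :: "'a center \<Rightarrow> 'a center \<Rightarrow> 'a center" is "(*)"
  by (rule ring_center_mult)
lift_definition inverse_center :: "'a center \<Rightarrow> 'a center" is inverse
  by (rule ring_center_inverse)
lift_definition divide_center :: "'a center \<Rightarrow> 'a center \<Rightarrow> 'a center" is "(/)"
  by (simp add: divide_inverse ring_center_mult ring_center_inverse)

instance
proof
  note rep = zero_center.rep_eq one_center.rep_eq plus_center.rep_eq minus_center.rep_eq
    uminus_center.rep_eq times_center.rep_eq inverse_center.rep_eq divide_center.rep_eq
    of_center_inject[symmetric]
  fix a b c :: "'a center"
  show "a * b * c = a * (b * c)" by (simp add: rep mult.assoc)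
  show "a * b = b * a" using of_center[of a] by (simp add: rep ring_center_def)
  show "1 * a = a" by (simp add: rep)
  show "a + b + c = a + (b + c)" by (simp add: rep add.assoc)
  show "a + b = b + a" by (simp add: rep add.commute)
  show "0 + a = a" by (simp add: rep)
  show "- a + a = 0" by (simp add: rep)
  show "a - b = a + - b" by (simp add: rep)
  show "(a + b) * c = a * c + b * c" by (simp add: rep distrib_right)
  show "(0 :: 'a center) \<noteq> 1" by (simp add: rep)
  show "a \<noteq> 0 \<Longrightarrow> inverse a * a = 1" by (simp add: rep)
  show "a div b = a * inverse b" by (simp add: rep divide_inverse)
  show "inverse (0 :: 'a center) = 0" by (simp add: rep)
qed

end

definition center_scale :: "'a::division_ring center \<Rightarrow> 'a \<Rightarrow> 'a" where
  "center_scale c x = of_center c * x"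

lemma vector_space_center_scale:
  "vector_space (center_scale :: 'a::division_ring center \<Rightarrow> 'a \<Rightarrow> 'a)"
  by standard
    (simp_all add: center_scale_def distrib_left distrib_right mult.assoc
      plus_center.rep_eq times_center.rep_eq one_center.rep_eq)

text \<open>The identity of a division subring is a nonzero idempotent, hence \<open>1\<close>.\<close>

definition division_subring :: "'a::division_ring set \<Rightarrow> bool" where
  "division_subring K \<longleftrightarrow> 1 \<in> K \<and> (\<forall>x\<in>K. \<forall>y\<in>K. x - y \<in> K \<and> x * y \<in> K)
     \<and> (\<forall>x\<in>K. x \<noteq> 0 \<longrightarrow> inverse x \<in> K)"

definition finite_dimensional_over_center :: "'a::division_ring set \<Rightarrow> bool" where
  "finite_dimensional_over_center V \<longleftrightarrow>
     (\<exists>B. finite B \<and> V = module.span center_scale B)"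

definition locally_finite :: "'a::division_ring itself \<Rightarrow> bool" where
  "locally_finite _ \<longleftrightarrow> (\<forall>S :: 'a set. finite S \<longrightarrow>
     finite_dimensional_over_center (division_subring hull (ring_center \<union> S)))"

definition mult_group :: "'a::division_ring monoid" where
  "mult_group = \<lparr>carrier = UNIV - {0}, mult = (*), one = 1\<rparr>"

lemma group_mult_group: "group (mult_group :: 'a::division_ring monoid)"
proof (rule groupI)
  fix x :: 'a
  assume "x \<in> carrier mult_group"
  then have "inverse x \<in> carrier mult_group" "inverse x \<otimes>\<^bsub>mult_group\<^esub> x = \<one>\<^bsub>mult_group\<^esub>"
    by (simp_all add: mult_group_def)
  then show "\<exists>y\<in>carrier mult_group. y \<otimes>\<^bsub>mult_group\<^esub> x = \<one>\<^bsub>mult_group\<^esub>" by blast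
qed (simp_all add: mult_group_def mult.assoc)

definition radical_over :: "'a::division_ring set \<Rightarrow> 'a set \<Rightarrow> bool" where
  "radical_over A K \<longleftrightarrow> (\<forall>x\<in>A. \<exists>n::nat. n > 0 \<and> x ^ n \<in> K)"

end

theory Submission
  imports Defs "HOL-Computational_Algebra.Polynomial" "HOL-Algebra.Multiplicative_Group"
    "HOL-Number_Theory.Residues"
begin

text \<open>Write \<open>F\<close> for the center of the division ring, and suppose that \<open>N\<close> contains an \<open>a\<close> that does
  not commute with some \<open>b\<close>.  Let \<open>D\<close> be the division subring generated by \<open>F\<close>, \<open>a\<close> and \<open>b\<close>.  It is
  finite dimensional over \<open>F\<close>; let \<open>Z\<close> be its own center, which may be larger than \<open>F\<close>.

  Radicality over \<open>K\<close> turns into radicality over \<open>Z\<close>.  For \<open>x \<notin> K\<close>, suitable equal powers of \<open>a\<close> and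
  of its conjugates by \<open>x\<close> and by \<open>1 + x\<close> lie in \<open>K\<close>.  The identity \<open>(C - B) x = A - C\<close> between these
  powers \<open>A\<close>, \<open>B\<close>, \<open>C\<close> would put \<open>x\<close> into \<open>K\<close> unless all three are equal.  Hence some power of \<open>a\<close>
  commutes with \<open>x\<close> (\<open>radical_power_commutes\<close>), and since \<open>D\<close> is spanned by finitely many elements,
  every element of \<open>N \<inter> D\<close> has a power in \<open>Z\<close> (\<open>radical_over_relative_center\<close>).  It remains to refute
  the existence of a noncentral normal subgroup of \<open>D\<close> that is radical over \<open>Z\<close>.

  Suppose first that \<open>F\<close> has a valuation ring \<open>A\<close> with a nonzero \<open>t\<close> in its maximal ideal
  (\<open>valuation_ring_exists\<close>).  In characteristic 0 take \<open>t = 3\<close>, and in characteristic \<open>p\<close> take any \<open>t\<close> that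
  is transcendental over the prime field, that is, not a root of unity.  The elements of \<open>D\<close> with
  coordinates in \<open>A\<close>, for a suitable basis, form a multiplicatively closed lattice \<open>M\<close>.  Commuting \<open>a\<close>
  with elements close to 1 produces a noncentral \<open>v \<in> N\<close> with \<open>v \<in> 1 + tM\<close>
  (\<open>noncentral_commutator_near_1\<close>).  Replacing \<open>v\<close> by a power, \<open>v\<^sup>q \<in> Z\<close> for a prime \<open>q\<close>.  Now
  \<open>v = f + s g\<close> with \<open>f \<in> Z\<close>, \<open>s \<in> tA\<close> and \<open>g \<in> M\<close> primitive modulo \<open>Z\<close>, and the linear term \<open>q s f\<^sup>q\<^sup>-\<^sup>1 g\<close> of
  \<open>v\<^sup>q\<close> dominates the others, so \<open>v\<^sup>q\<close> is not in \<open>Z\<close> (\<open>tame_power_not_central\<close>), unless \<open>q\<close> is the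
  characteristic \<open>p\<close>.

  In that exceptional case conjugation by \<open>v\<close> is unipotent, and some \<open>y\<close> satisfies
  \<open>v y v\<^sup>-\<^sup>1 = y + 1\<close>.  For central \<open>z\<close> the quotient \<open>(y + z + 1)/(y + z)\<close> is in \<open>N\<close>, so a power of it is
  fixed by conjugation with \<open>v\<close>.  Comparing the quotient with its conjugate shows that \<open>y + z + 1\<close> is
  a root of unity, for every \<open>z\<close>; so \<open>Z\<close>, and with it \<open>t\<close>, is algebraic over the prime field
  (\<open>inseparable_center_torsion\<close>), a contradiction.

  What is left is the case that \<open>F\<close> is algebraic over a finite field.  Then so is \<open>D\<close>, and \<open>D\<close> is
  commutative by Jacobson's theorem (\<open>jacobson_torsion_commutative\<close>), which is reduced to Wedderburn's
  theorem on finite division rings (\<open>wedderburn\<close>).\<close>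

section \<open>Division subrings and their centers\<close>

lemma division_subringD:
  assumes "division_subring K"
  shows "0 \<in> K" "1 \<in> K" "x \<in> K \<Longrightarrow> y \<in> K \<Longrightarrow> x + y \<in> K"
    "x \<in> K \<Longrightarrow> y \<in> K \<Longrightarrow> x - y \<in> K" "x \<in> K \<Longrightarrow> - x \<in> K"
    "x \<in> K \<Longrightarrow> y \<in> K \<Longrightarrow> x * y \<in> K" "x \<in> K \<Longrightarrow> inverse x \<in> K"
    "x \<in> K \<Longrightarrow> x ^ n \<in> K" "of_nat m \<in> K"
proof -
  show 1: "1 \<in> K" and diff: "x \<in> K \<Longrightarrow> y \<in> K \<Longrightarrow> x - y \<in> K"
    and mult: "x \<in> K \<Longrightarrow> y \<in> K \<Longrightarrow> x * y \<in> K" for x y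
    using assms by (auto simp: division_subring_def)
  show 0: "0 \<in> K" using diff[OF 1 1] by simp
  show uminus: "x \<in> K \<Longrightarrow> - x \<in> K" for x using diff[OF 0, of x] by simp
  show add: "x \<in> K \<Longrightarrow> y \<in> K \<Longrightarrow> x + y \<in> K" for x y using diff[OF _ uminus, of x y] by simp
  show "x \<in> K \<Longrightarrow> inverse x \<in> K"
    using assms 0 by (cases "x = 0") (auto simp: division_subring_def)
  show "x \<in> K \<Longrightarrow> x ^ n \<in> K" by (induction n) (auto intro: 1 mult)
  show "of_nat m \<in> K" by (induction m) (auto intro: 0 1 add)
qed

lemma division_subring_sum:
  assumes "division_subring K" "\<And>i. i \<in> I \<Longrightarrow> f i \<in> K"
  shows "sum f I \<in> K"
  using assms(2) by (induction I rule: infinite_finite_induct)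
    (auto intro: division_subringD[OF assms(1)])

lemma division_subring_hull: "division_subring (division_subring hull S)"
  by (rule hull_in) (auto simp: division_subring_def)

lemma commute_inverse:
  fixes x y :: "'a::division_ring"
  assumes "x * y = y * x"
  shows "inverse x * y = y * inverse x"
proof (cases "x = 0")
  case False
  have "inverse x * y = inverse x * (y * x) * inverse x"
    using False by (simp add: mult.assoc)
  also have "\<dots> = inverse x * (x * y) * inverse x" using assms by simp
  also have "\<dots> = y * inverse x" using False by (simp add: mult.assoc[symmetric])
  finally show ?thesis .
qed simp

lemma commute_mult:
  fixes x y z :: "'a::semigroup_mult"
  assumes "x * z = z * x" "y * z = z * y"
  shows "(x * y) * z = z * (x * y)"
  using assms by (metis mult.assoc)

lemma commute_power:
  fixes x y :: "'a::monoid_mult"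
  assumes "x * y = y * x"
  shows "x ^ n * y = y * x ^ n"
  by (induction n) (auto simp: assms commute_mult)

lemma commute_power2:
  fixes x y :: "'a::monoid_mult"
  assumes "x * y = y * x"
  shows "x ^ n * y ^ m = y ^ m * x ^ n"
  by (rule commute_power, rule commute_power[symmetric], simp add: assms)

lemma commute_sum:
  fixes f :: "'b \<Rightarrow> 'a::semiring_0"
  assumes "\<And>i. i \<in> I \<Longrightarrow> f i * z = z * f i"
  shows "sum f I * z = z * sum f I"
  by (simp add: sum_distrib_left sum_distrib_right assms)

lemma conj_power:
  fixes x a :: "'a::division_ring"
  assumes "x \<noteq> 0"
  shows "(x * a * inverse x) ^ n = x * a ^ n * inverse x"
proof (induction n)
  case (Suc n)
  have "(x * a * inverse x) ^ Suc n = x * a * (inverse x * x) * a ^ n * inverse x"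
    unfolding power_Suc Suc by (simp add: mult.assoc)
  also have "\<dots> = x * a ^ Suc n * inverse x" using assms by (simp add: mult.assoc)
  finally show ?case .
qed (use assms in simp)

lemma power_mult_distrib_commute:
  fixes x y :: "'a::monoid_mult"
  assumes "x * y = y * x"
  shows "(x * y) ^ n = x ^ n * y ^ n"
proof (induction n)
  case (Suc n)
  have "(x * y) ^ Suc n = x * (y * x ^ n) * y ^ n" by (simp add: Suc mult.assoc)
  also have "y * x ^ n = x ^ n * y" by (rule commute_power[symmetric, OF assms])
  finally show ?case by (simp add: mult.assoc)
qed simp

lemma binomial_commute:
  fixes x y :: "'a::ring_1"
  assumes xy: "x * y = y * x"
  shows "(x + y) ^ n = (\<Sum>k\<le>n. of_nat (n choose k) * x ^ k * y ^ (n - k))"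
proof (induction n)
  case (Suc n)
  have *: "y * (of_nat (n choose k) * x ^ k * y ^ (n - k)) = of_nat (n choose k) * x ^ k * y ^ (Suc n - k)"
    if "k \<le> n" for k
  proof -
    have "y * (of_nat (n choose k) * x ^ k) = of_nat (n choose k) * (y * x ^ k)"
      using mult_of_nat_commute[of "n choose k" y] by (metis mult.assoc)
    also have "y * x ^ k = x ^ k * y" by (rule commute_power[OF xy, symmetric])
    finally have "y * (of_nat (n choose k) * x ^ k) * y ^ (n - k)
        = of_nat (n choose k) * x ^ k * (y * y ^ (n - k))"
      by (simp add: mult.assoc)
    then show ?thesis using that by (simp add: Suc_diff_le mult.assoc)
  qed
  have "(x + y) ^ Suc n = x * (\<Sum>k\<le>n. of_nat (n choose k) * x ^ k * y ^ (n - k))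
      + y * (\<Sum>k\<le>n. of_nat (n choose k) * x ^ k * y ^ (n - k))"
    by (simp add: Suc distrib_right)
  also have "x * (\<Sum>k\<le>n. of_nat (n choose k) * x ^ k * y ^ (n - k))
      = (\<Sum>k\<le>n. of_nat (n choose k) * x ^ Suc k * y ^ (n - k))"
    unfolding sum_distrib_left
  proof (rule sum.cong[OF refl])
    fix k
    show "x * (of_nat (n choose k) * x ^ k * y ^ (n - k)) = of_nat (n choose k) * x ^ Suc k * y ^ (n - k)"
      by (simp only: power_Suc mult.assoc[symmetric] mult_of_nat_commute[of "n choose k" x])
  qed
  also have "y * (\<Sum>k\<le>n. of_nat (n choose k) * x ^ k * y ^ (n - k))
      = (\<Sum>k\<le>n. of_nat (n choose k) * x ^ k * y ^ (Suc n - k))"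
    unfolding sum_distrib_left by (rule sum.cong[OF refl]) (simp add: *)
  also have "\<dots> = (\<Sum>k\<le>Suc n. of_nat (n choose k) * x ^ k * y ^ (Suc n - k))"
    by (simp add: binomial_eq_0)
  also have "\<dots> = y ^ Suc n + (\<Sum>k\<le>n. of_nat (n choose Suc k) * x ^ Suc k * y ^ (n - k))"
    by (subst sum.atMost_Suc_shift) simp
  finally have "(x + y) ^ Suc n = y ^ Suc n
      + (\<Sum>k\<le>n. of_nat (Suc n choose Suc k) * x ^ Suc k * y ^ (n - k))"
    by (simp add: sum.distrib distrib_right add_ac)
  then show ?case by (subst sum.atMost_Suc_shift) simp
qed simp

text \<open>The center of the division ring \<open>D\<close> itself.  Membership in \<open>D\<close> is part of it, so it differs from
  the centralizer of \<open>D\<close> in the whole ring.\<close>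

definition relative_center :: "'a::division_ring set \<Rightarrow> 'a set" where
  "relative_center D = {z \<in> D. \<forall>x\<in>D. z * x = x * z}"

lemma division_subring_commutant:
  assumes "division_subring D"
  shows "division_subring {z \<in> D. \<forall>x\<in>S. z * x = x * z}"
  unfolding division_subring_def
proof (intro conjI ballI impI)
  note D = division_subringD[OF assms]
  fix x y assume x: "x \<in> {z \<in> D. \<forall>x\<in>S. z * x = x * z}"
  show "inverse x \<in> {z \<in> D. \<forall>x\<in>S. z * x = x * z}"
    using x D(7) commute_inverse[of x] by auto
  assume y: "y \<in> {z \<in> D. \<forall>x\<in>S. z * x = x * z}"
  show "x - y \<in> {z \<in> D. \<forall>x\<in>S. z * x = x * z}"
    using x y D(4) by (simp add: left_diff_distrib right_diff_distrib)
  show "x * y \<in> {z \<in> D. \<forall>x\<in>S. z * x = x * z}"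
    using x y D(6) commute_mult[of x _ y] by auto
qed (use division_subringD[OF assms] in auto)

lemma division_subring_relative_center:
  "division_subring D \<Longrightarrow> division_subring (relative_center D)"
  unfolding relative_center_def by (rule division_subring_commutant)

lemma division_subring_ring_center: "division_subring (ring_center :: 'a::division_ring set)"
proof -
  have "(ring_center :: 'a set) = {z \<in> UNIV. \<forall>x\<in>UNIV. z * x = x * z}"
    by (auto simp: ring_center_def)
  moreover have "division_subring (UNIV :: 'a set)" by (simp add: division_subring_def)
  ultimately show ?thesis using division_subring_commutant[of "UNIV :: 'a set" UNIV] by simp
qed

lemma ring_centerD: "z \<in> ring_center \<Longrightarrow> z * x = x * z"
  by (simp add: ring_center_def)

lemma relative_centerD: "z \<in> relative_center D \<Longrightarrow> x \<in> D \<Longrightarrow> z * x = x * z"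
  by (simp add: relative_center_def)

lemma prime_characteristic:
  assumes "n > 0" "of_nat n = (0 :: 'a::division_ring)"
  shows "\<exists>p. prime p \<and> of_nat p = (0 :: 'a)"
proof -
  define p where "p = (LEAST p. p > 0 \<and> of_nat p = (0 :: 'a))"
  have p: "p > 0" "of_nat p = (0 :: 'a)"
    using LeastI[of "\<lambda>p. p > 0 \<and> of_nat p = (0 :: 'a)" n] assms by (auto simp: p_def)
  have least: "of_nat k \<noteq> (0 :: 'a)" if "k < p" "k > 0" for k
    using not_less_Least[of k "\<lambda>p. p > 0 \<and> of_nat p = (0 :: 'a)"] that by (auto simp: p_def)
  have "p \<noteq> 1" using p by (metis of_nat_1 zero_neq_one)
  moreover have "d = 1 \<or> d = p" if dvd: "d dvd p" for d
  proof (rule ccontr)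
    assume d: "\<not> (d = 1 \<or> d = p)"
    obtain e where e: "p = d * e" using dvd by (rule dvdE)
    have "e > 0" "d > 0" using e p by (auto intro: Nat.gr0I)
    moreover have "d < p" using d dvd p by (simp add: dvd_imp_le le_neq_implies_less)
    moreover have "e < p" using \<open>d > 0\<close> \<open>e > 0\<close> d e by (metis less_one linorder_neqE_nat mult_less_cancel2 nat_mult_1 not_less0)
    ultimately have "of_nat d \<noteq> (0 :: 'a)" "of_nat e \<noteq> (0 :: 'a)" using least by auto
    then show False using p e by simp
  qed
  ultimately have "prime p" using p(1) unfolding prime_nat_iff by auto
  with p show ?thesis by auto
qed

section \<open>Torsion elements in positive characteristic\<close>

text \<open>In characteristic \<open>p\<close> a nonzero element is torsion if and only if it is algebraic over the prime
  field.  The closure properties of algebraic elements are therefore obtained by counting: an element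
  is torsion as soon as its powers lie in a finite set.\<close>

definition torsion :: "'a::monoid_mult \<Rightarrow> bool" where
  "torsion x \<longleftrightarrow> (\<exists>n>0. x ^ n = 1)"

lemma power_mod_period:
  fixes x :: "'a::monoid_mult"
  assumes "x ^ n = 1"
  shows "x ^ (k mod n) = x ^ k"
proof -
  have "x ^ k = x ^ (n * (k div n) + k mod n)" by simp
  also have "\<dots> = x ^ (k mod n)" unfolding power_add power_mult assms by simp
  finally show ?thesis by simp
qed

lemma torsion_powers_finite:
  assumes "torsion x"
  shows "finite (range (\<lambda>n::nat. x ^ n))"
proof -
  obtain n where n: "n > 0" "x ^ n = 1" using assms by (auto simp: torsion_def)
  have "range (\<lambda>n::nat. x ^ n) \<subseteq> (\<lambda>i. x ^ i) ` {..<n}"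
    using power_mod_period[OF n(2)] n(1) by (metis (mono_tags, lifting) image_eqI image_subsetI lessThan_iff mod_less_divisor)
  then show ?thesis by (rule finite_subset) simp
qed

lemma torsion_if_powers_finite:
  fixes x :: "'a::division_ring"
  assumes "x \<noteq> 0" "\<And>n::nat. x ^ n \<in> S" "finite S"
  shows "torsion x"
proof -
  have "\<not> inj (\<lambda>n::nat. x ^ n)"
    using assms(2,3) by (meson finite_imageD finite_subset image_subsetI infinite_UNIV_nat)
  then obtain m n :: nat where mn: "m < n" "x ^ m = x ^ n"
    unfolding inj_def by (metis linorder_neqE_nat)
  have "x ^ m * x ^ (n - m) = x ^ m * 1" using mn by (metis le_add_diff_inverse less_imp_le_nat mult_1_right power_add)
  then have "x ^ (n - m) = 1" using assms(1) by simp
  then show ?thesis using mn by (auto simp: torsion_def intro!: exI[of _ "n - m"])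
qed

definition additive_span :: "'a::semiring_1 set \<Rightarrow> 'a set" where
  "additive_span G = range (\<lambda>c. \<Sum>g\<in>G. of_nat (c g) * g)"

lemma additive_span_add:
  "x \<in> additive_span G \<Longrightarrow> y \<in> additive_span G \<Longrightarrow> x + y \<in> additive_span G"
proof -
  assume "x \<in> additive_span G" "y \<in> additive_span G"
  then obtain c d where "x = (\<Sum>g\<in>G. of_nat (c g) * g)" "y = (\<Sum>g\<in>G. of_nat (d g) * g)"
    by (auto simp: additive_span_def)
  then have "x + y = (\<Sum>g\<in>G. of_nat (c g + d g) * g)"
    by (simp add: sum.distrib distrib_right)
  then show ?thesis
    unfolding additive_span_def by (intro image_eqI[of _ _ "\<lambda>g. c g + d g"]) auto
qed

lemma additive_span_0: "0 \<in> additive_span G"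
  unfolding additive_span_def by (rule range_eqI[of _ _ "\<lambda>_. 0"]) simp

lemma additive_span_base:
  assumes "finite G" "g \<in> G"
  shows "g \<in> additive_span G"
proof -
  have "(\<Sum>h\<in>G. of_nat (if h = g then 1 else 0) * h) = (\<Sum>h\<in>G. if h = g then g else 0)"
    by (rule sum.cong) auto
  also have "\<dots> = g" using assms by simp
  finally show ?thesis
    unfolding additive_span_def by (intro image_eqI[of _ _ "\<lambda>h. if h = g then 1 else 0"]) auto
qed

lemma additive_span_of_nat_mult:
  "x \<in> additive_span G \<Longrightarrow> of_nat n * x \<in> additive_span G"
  by (induction n) (auto simp: distrib_right additive_span_0 additive_span_add)

lemma additive_span_sum:
  "(\<And>i. i \<in> I \<Longrightarrow> f i \<in> additive_span G) \<Longrightarrow> sum f I \<in> additive_span G"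
  by (induction I rule: infinite_finite_induct) (auto simp: additive_span_0 additive_span_add)

lemma additive_span_mult:
  fixes x y :: "'a::ring_1"
  assumes "finite G" "\<And>g h. g \<in> G \<Longrightarrow> h \<in> G \<Longrightarrow> g * h \<in> G"
    and "x \<in> additive_span G" "y \<in> additive_span G"
  shows "x * y \<in> additive_span G"
proof -
  obtain c d where cd: "x = (\<Sum>g\<in>G. of_nat (c g) * g)" "y = (\<Sum>g\<in>G. of_nat (d g) * g)"
    using assms by (auto simp: additive_span_def)
  have "x * y = (\<Sum>g\<in>G. \<Sum>h\<in>G. of_nat (c g) * g * (of_nat (d h) * h))"
    by (simp add: cd sum_product)
  also have "\<dots> = (\<Sum>g\<in>G. \<Sum>h\<in>G. of_nat (c g * d h) * (g * h))"
    by (intro sum.cong refl) (metis (no_types, lifting) mult.assoc mult_of_nat_commute of_nat_mult)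
  also have "\<dots> \<in> additive_span G"
    by (intro additive_span_sum additive_span_of_nat_mult additive_span_base assms)
  finally show ?thesis .
qed

text \<open>In positive characteristic only finitely many integer coefficients matter, so a finite
  multiplicatively closed set generates a finite ring.\<close>

lemma finite_additive_span:
  assumes "p > 0" "of_nat p = (0 :: 'a::semiring_1)" "finite (G :: 'a set)"
  shows "finite (additive_span G)"
proof -
  have mod: "of_nat (n mod p) = (of_nat n :: 'a)" for n
    by (metis add.right_neutral assms(2) mod_mult_div_eq mult_zero_left of_nat_add of_nat_mult)
  have "additive_span G \<subseteq> (\<lambda>c. \<Sum>g\<in>G. of_nat (c g) * g) ` (G \<rightarrow>\<^sub>E {..<p})"
  proof
    fix x assume "x \<in> additive_span G"
    then obtain c where c: "x = (\<Sum>g\<in>G. of_nat (c g) * g)" by (auto simp: additive_span_def)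
    have "x = (\<Sum>g\<in>G. of_nat (restrict (\<lambda>g. c g mod p) G g) * g)"
      unfolding c by (rule sum.cong) (auto simp: mod)
    moreover have "restrict (\<lambda>g. c g mod p) G \<in> G \<rightarrow>\<^sub>E {..<p}" using assms(1) by auto
    ultimately show "x \<in> (\<lambda>c. \<Sum>g\<in>G. of_nat (c g) * g) ` (G \<rightarrow>\<^sub>E {..<p})" by (rule image_eqI)
  qed
  moreover have "finite (G \<rightarrow>\<^sub>E {..<p})" using assms(3) by (intro finite_PiE) auto
  ultimately show ?thesis by (meson finite_imageI finite_subset)
qed

lemma additive_span_uminus:
  fixes x :: "'a::ring_1"
  assumes "p > 0" "of_nat p = (0 :: 'a)" "x \<in> additive_span G"
  shows "- x \<in> additive_span G"
proof -
  have "of_nat (p - 1) = (- 1 :: 'a)" using assms(1,2) by (simp add: of_nat_diff)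
  then have "- x = of_nat (p - 1) * x" by simp
  then show ?thesis using additive_span_of_nat_mult[OF assms(3)] by metis
qed

lemma torsion_diff:
  fixes x z :: "'a::division_ring"
  assumes "p > 0" "of_nat p = (0 :: 'a)" and "x * z = z * x" "torsion x" "torsion z" "x \<noteq> z"
  shows "torsion (x - z)"
proof -
  define G where "G = (\<lambda>(u, v). u * v) ` (range (\<lambda>n::nat. x ^ n) \<times> range (\<lambda>n::nat. z ^ n))"
  have fin: "finite G"
    unfolding G_def using assms(4,5) by (intro finite_imageI finite_cartesian_product torsion_powers_finite)
  have G: "x ^ i * z ^ j \<in> G" for i j unfolding G_def by auto
  have mult: "g * h \<in> G" if "g \<in> G" "h \<in> G" for g h
  proof -
    obtain i j k l where "g = x ^ i * z ^ j" "h = x ^ k * z ^ l" using \<open>g \<in> G\<close> \<open>h \<in> G\<close> by (auto simp: G_def)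
    moreover have "x ^ i * z ^ j * (x ^ k * z ^ l) = x ^ i * (x ^ k * z ^ j) * z ^ l"
      using commute_power2[OF assms(3), of k j] by (simp add: mult.assoc)
    moreover have "\<dots> = x ^ (i + k) * z ^ (j + l)" by (simp add: power_add mult.assoc)
    ultimately show ?thesis using G by simp
  qed
  have x: "x \<in> additive_span G" and z: "z \<in> additive_span G" and 1: "1 \<in> additive_span G"
    using G[of 1 0] G[of 0 1] G[of 0 0] fin by (auto intro: additive_span_base)
  have "x - z \<in> additive_span G"
    using additive_span_add[OF x additive_span_uminus[OF assms(1,2) z]] by simp
  then have "(x - z) ^ n \<in> additive_span G" for n
    by (induction n) (auto intro: 1 additive_span_mult[OF fin mult])
  then show ?thesis
    using torsion_if_powers_finite[OF _ _ finite_additive_span[OF assms(1,2) fin], of "x - z"] assms(6) by simp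
qed

text \<open>The equation for \<open>x\<^sup>d\<close> makes the finite set of all \<open>R\<close>-combinations of \<open>1, x, \<dots>, x\<^sup>d\<^sup>-\<^sup>1\<close> closed under
  multiplication by \<open>x\<close>, so it contains all powers of \<open>x\<close>.\<close>

lemma torsion_integral:
  fixes x :: "'a::division_ring"
  assumes "finite R" "0 \<in> R" "1 \<in> R" "\<And>r s. r \<in> R \<Longrightarrow> s \<in> R \<Longrightarrow> r + s \<in> R \<and> r * s \<in> R"
    and comm: "\<And>r. r \<in> R \<Longrightarrow> r * x = x * r"
    and c: "\<And>i. c i \<in> R" and eq: "x ^ d = (\<Sum>i<d. c i * x ^ i)" and "x \<noteq> 0"
  shows "torsion x"
proof -
  define T where "T = (\<lambda>r. \<Sum>i<d. r i * x ^ i) ` ({..<d} \<rightarrow>\<^sub>E R)"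
  have T: "(\<Sum>i<d. r i * x ^ i) \<in> T" if "\<And>i. i < d \<Longrightarrow> r i \<in> R" for r
  proof -
    have "(\<Sum>i<d. r i * x ^ i) = (\<Sum>i<d. restrict r {..<d} i * x ^ i)" by (rule sum.cong) auto
    moreover have "restrict r {..<d} \<in> {..<d} \<rightarrow>\<^sub>E R" using that by auto
    ultimately show ?thesis unfolding T_def by (rule image_eqI)
  qed
  have "d \<noteq> 0" using eq assms(8) by (intro notI) simp
  then obtain e where e: "d = Suc e" by (cases d) auto
  have step: "x * y \<in> T" if "y \<in> T" for y
  proof -
    obtain r where r: "\<And>i. i < d \<Longrightarrow> r i \<in> R" "y = (\<Sum>i<d. r i * x ^ i)"
      using \<open>y \<in> T\<close> by (auto simp: T_def)
    define s where "s i = (case i of 0 \<Rightarrow> 0 | Suc j \<Rightarrow> r j) + r e * c i" for i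
    have "x * y = (\<Sum>i<d. r i * x ^ Suc i)"
      unfolding r(2) sum_distrib_left
      by (rule sum.cong) (auto simp: r(1) comm mult.assoc[symmetric])
    also have "\<dots> = (\<Sum>i<e. r i * x ^ Suc i) + r e * x ^ d" by (simp add: e)
    also have "(\<Sum>i<e. r i * x ^ Suc i) = (\<Sum>i<d. (case i of 0 \<Rightarrow> 0 | Suc j \<Rightarrow> r j) * x ^ i)"
      unfolding e sum.lessThan_Suc_shift by simp
    also have "r e * x ^ d = (\<Sum>i<d. r e * c i * x ^ i)"
      by (simp add: eq sum_distrib_left mult.assoc)
    finally have "x * y = (\<Sum>i<d. s i * x ^ i)" by (simp add: s_def sum.distrib distrib_right)
    moreover have "s i \<in> R" if "i < d" for i
      using that r(1) c assms(2,4) e by (auto simp: s_def split: nat.split)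
    ultimately show ?thesis using T by simp
  qed
  have "(\<Sum>i<d. (if i = 0 then 1 else 0) * x ^ i) \<in> T" using assms(2,3) by (intro T) auto
  moreover have "(\<Sum>i<d. (if i = 0 then 1 else 0) * x ^ i) = 1"
    unfolding e sum.lessThan_Suc_shift by simp
  ultimately have "1 \<in> T" by simp
  then have "x ^ n \<in> T" for n by (induction n) (auto intro: step)
  moreover have "finite T" unfolding T_def using assms(1) by (intro finite_imageI finite_PiE) auto
  ultimately show ?thesis using torsion_if_powers_finite assms(8) by blast
qed

text \<open>A field that is algebraic over a finite field is the union of its finite subrings.\<close>

lemma finite_ring_of_torsion:
  assumes "p > 0" "of_nat p = (0 :: 'a::division_ring)"
    and "finite C" "C \<subseteq> ring_center" "\<And>c. c \<in> C \<Longrightarrow> c \<noteq> 0 \<Longrightarrow> torsion c"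
  shows "\<exists>R :: 'a set. finite R \<and> C \<subseteq> R \<and> R \<subseteq> ring_center \<and> 0 \<in> R \<and> 1 \<in> R
    \<and> (\<forall>r\<in>R. \<forall>s\<in>R. r + s \<in> R \<and> r * s \<in> R)"
  using assms(3,4,5)
proof (induction C)
  case empty
  have G: "g * h \<in> {1 :: 'a}" if "g \<in> {1 :: 'a}" "h \<in> {1}" for g h using that by simp
  have "additive_span {1 :: 'a} \<subseteq> ring_center"
    by (auto simp: additive_span_def intro: division_subringD[OF division_subring_ring_center])
  then show ?case
    using finite_additive_span[OF assms(1,2), of "{1}"] additive_span_base[of "{1 :: 'a}" 1]
      additive_span_mult[OF _ G] additive_span_add[of _ "{1 :: 'a}"] additive_span_0[of "{1 :: 'a}"]
    by (intro exI[of _ "additive_span {1}"]) auto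
next
  case (insert c C)
  from insert.IH insert.prems obtain R :: "'a set" where R: "finite R" "C \<subseteq> R" "R \<subseteq> ring_center" "0 \<in> R" "1 \<in> R"
      "\<And>r s. r \<in> R \<Longrightarrow> s \<in> R \<Longrightarrow> r + s \<in> R \<and> r * s \<in> R"
    by (metis insert_subset insertI2)
  have c: "c \<in> ring_center" using insert.prems by simp
  note F = division_subringD[OF division_subring_ring_center]
  define G where "G = (\<lambda>(r, u). r * u) ` (R \<times> range (\<lambda>n::nat. c ^ n))"
  have "finite (range (\<lambda>n::nat. c ^ n))"
  proof (cases "c = 0")
    case True
    then have "range (\<lambda>n::nat. c ^ n) \<subseteq> {0, 1}" by (auto simp: power_0_left)
    then show ?thesis by (rule finite_subset) simp
  next
    case False
    then show ?thesis using insert.prems by (intro torsion_powers_finite) auto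
  qed
  then have fin: "finite G" unfolding G_def using R(1) by simp
  have G: "r * c ^ i \<in> G" if "r \<in> R" for r i unfolding G_def using that by auto
  have mult: "g * h \<in> G" if "g \<in> G" "h \<in> G" for g h
  proof -
    obtain r i s j where rs: "r \<in> R" "s \<in> R" "g = r * c ^ i" "h = s * c ^ j"
      using \<open>g \<in> G\<close> \<open>h \<in> G\<close> by (auto simp: G_def)
    have "g * h = r * (c ^ i * s) * c ^ j" by (simp add: rs mult.assoc)
    also have "\<dots> = r * s * c ^ (i + j)"
      using ring_centerD[OF F(8)[OF c], of i s] by (simp add: power_add mult.assoc)
    finally show ?thesis using G R(6) rs by simp
  qed
  have sub: "R \<subseteq> additive_span G" using G[of _ 0] fin by (auto intro: additive_span_base)
  have "c \<in> additive_span G" using G[OF R(5), of 1] fin by (auto intro: additive_span_base)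
  moreover have "G \<subseteq> ring_center" using R(3) c by (auto simp: G_def intro!: F)
  then have "additive_span G \<subseteq> ring_center"
    by (auto simp: additive_span_def intro!: division_subring_sum[OF division_subring_ring_center] F)
  ultimately show ?case
    using sub R additive_span_mult[OF fin mult] additive_span_add[of _ G]
      finite_additive_span[OF assms(1,2) fin]
    by (intro exI[of _ "additive_span G"]) auto
qed

section \<open>Division rings all of whose nonzero elements are torsion\<close>

lemma geometric_sum_ring:
  fixes c :: "'a::ring_1"
  shows "(c - 1) * (\<Sum>i<n. c ^ i) = c ^ n - 1"
  by (induction n) (simp_all add: algebra_simps)

text \<open>The Frobenius identity \<open>(1 + u)\<^sup>p = 1 + u\<^sup>p\<close> leaves \<open>u\<^sup>p = 0\<close>, and there are no zero divisors.\<close>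

lemma power_prime_characteristic_eq_1:
  fixes x :: "'a::division_ring"
  assumes p: "prime p" "of_nat p = (0 :: 'a)" and "x ^ p = 1"
  shows "x = 1"
proof -
  define u where "u = x - 1"
  obtain q where q: "p = Suc q" using prime_gt_0_nat[OF p(1)] by (cases p) auto
  have "of_nat (p choose k) * u ^ k * 1 ^ (p - k) = 0" if "k \<in> {1..q}" for k
  proof -
    have "p dvd (p choose k)" using that q by (intro dvd_choose_prime p) auto
    then obtain l where "p choose k = p * l" by auto
    then show ?thesis using p(2) by simp
  qed
  then have mid: "(\<Sum>k\<in>{1..q}. of_nat (p choose k) * u ^ k * 1 ^ (p - k)) = 0" by (rule sum.neutral[OF ballI])
  have "{..p} = insert 0 (insert p {1..q})" using q by auto
  moreover have "(u + 1) ^ p = (\<Sum>k\<le>p. of_nat (p choose k) * u ^ k * 1 ^ (p - k))"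
    by (rule binomial_commute) simp
  ultimately have "(u + 1) ^ p = 1 + u ^ p" using mid q by simp
  then have "u ^ p = 0" using assms(3) by (simp add: u_def)
  then show ?thesis by (simp add: u_def)
qed

lemma power_coprime_eq_1:
  fixes x :: "'a::monoid_mult"
  assumes "x ^ m = 1" "x ^ n = 1" "coprime m n" "m > 0"
  shows "x = 1"
proof -
  obtain i j where "m * i = n * j + 1" using bezout_nat[of m n] assms(3,4) by auto
  then have "(x ^ m) ^ i = (x ^ n) ^ j * x" by (metis power_add power_mult power_one_right)
  then show ?thesis using assms by simp
qed

text \<open>Left and right multiplication by an element \<open>a\<close> of order \<open>m\<close> are commuting operators.  A discrete
  Fourier transform writes \<open>m x\<close> as the sum of the \<open>T j = (\<Sum>i<m. a\<^sup>-\<^sup>i\<^sup>j x a\<^sup>i)\<close>, and these satisfy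
  \<open>T j * a = a\<^sup>j * T j\<close>.  If every nonzero \<open>T j\<close> commuted with \<open>a\<close>, so would \<open>x\<close>.\<close>

lemma torsion_normalized:
  fixes a x :: "'a::division_ring"
  assumes D: "division_subring D" "a \<in> D" "x \<in> D"
    and m: "m > 0" "a ^ m = 1" "\<And>k. 0 < k \<Longrightarrow> k < m \<Longrightarrow> a ^ k \<noteq> 1" "of_nat m \<noteq> (0 :: 'a)"
    and xa: "x * a \<noteq> a * x"
  shows "\<exists>y\<in>D. \<exists>j. y \<noteq> 0 \<and> y * a = a ^ j * y \<and> a ^ j \<noteq> a"
proof (rule ccontr)
  assume contra: "\<not> ?thesis"
  have a0: "a \<noteq> 0" using xa by auto
  define b where "b = inverse a"
  have bm: "b ^ m = 1" using m(2) by (simp add: b_def power_inverse)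
  have ab: "a ^ k * b ^ k = 1" for k using a0 by (simp add: b_def power_inverse)
  define f where "f j i = b ^ (i * j) * x * a ^ i" for i j
  define T where "T j = (\<Sum>i<m. f j i)" for j
  note closed = division_subringD[OF D(1)]
  have TD: "T j \<in> D" for j
    unfolding T_def f_def b_def by (intro division_subring_sum[OF D(1)] closed D(2,3))
  have Ta: "T j * a = a ^ j * T j" for j
  proof -
    have step: "f j i * a = a ^ j * f j (Suc i)" for i
    proof -
      have "a ^ j * f j (Suc i) = (a ^ j * b ^ j) * b ^ (i * j) * x * (a * a ^ i)"
        by (simp add: f_def power_add mult.assoc)
      then show ?thesis by (simp add: ab f_def mult.assoc power_commutes)
    qed
    have "f j m = f j 0" by (simp add: f_def m(2) power_mult bm)
    moreover have "f j 0 + (\<Sum>i<m. f j (Suc i)) = (\<Sum>i<m. f j i) + f j m"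
      by (metis sum.lessThan_Suc sum.lessThan_Suc_shift)
    ultimately have "(\<Sum>i<m. f j (Suc i)) = T j" by (simp add: T_def)
    moreover have "T j * a = a ^ j * (\<Sum>i<m. f j (Suc i))"
      unfolding T_def sum_distrib_right step by (rule sum_distrib_left[symmetric])
    ultimately show ?thesis by simp
  qed
  have comm: "T j * a = a * T j" for j
  proof (cases "T j = 0")
    case False
    then have "a ^ j = a" using contra Ta[of j] TD[of j] by blast
    then show ?thesis using Ta[of j] by simp
  qed simp
  have inner: "(\<Sum>j<m. b ^ (i * j)) = (if i = 0 then of_nat m else 0)" if "i < m" for i
  proof (cases "i = 0")
    case False
    have "b ^ i \<noteq> 1" using m(3)[of i] False that ab[of i] by (metis gr0I mult_1_right)
    moreover have "(b ^ i - 1) * (\<Sum>j<m. (b ^ i) ^ j) = 0"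
      unfolding geometric_sum_ring using bm by (metis cancel_comm_monoid_add_class.diff_cancel mult.commute power_mult power_one)
    ultimately show ?thesis using False by (simp add: power_mult)
  qed simp
  have "(\<Sum>j<m. T j) = (\<Sum>i<m. \<Sum>j<m. f j i)" unfolding T_def by (rule sum.swap)
  also have "\<dots> = (\<Sum>i<m. (\<Sum>j<m. b ^ (i * j)) * x * a ^ i)"
    by (simp add: f_def sum_distrib_right)
  also have "\<dots> = (\<Sum>i<m. if i = 0 then of_nat m * x else 0)" by (rule sum.cong) (auto simp: inner)
  also have "\<dots> = of_nat m * x" using m(1) by simp
  finally have sum: "(\<Sum>j<m. T j) = of_nat m * x" .
  have "of_nat m * x * a = a * (of_nat m * x)"
    unfolding sum[symmetric] by (rule commute_sum) (rule comm)
  also have "\<dots> = of_nat m * (a * x)" by (metis mult.assoc mult_of_nat_commute)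
  finally show False using m(4) xa by (simp add: mult.assoc)
qed

text \<open>The order is prime to the characteristic, as \<open>p\<close>-th roots of unity are trivial.  This is what makes
  the Fourier transform above invertible.\<close>

lemma torsion_order:
  fixes a :: "'a::division_ring"
  assumes "prime p" "of_nat p = (0 :: 'a)" "torsion a"
  shows "\<exists>m>0. a ^ m = 1 \<and> (\<forall>k. 0 < k \<longrightarrow> k < m \<longrightarrow> a ^ k \<noteq> 1) \<and> of_nat m \<noteq> (0 :: 'a)"
proof -
  define m where "m = (LEAST m. m > 0 \<and> a ^ m = 1)"
  have m: "m > 0 \<and> a ^ m = 1"
    unfolding m_def using assms(3) unfolding torsion_def
    by (rule LeastI_ex[of "\<lambda>m. m > 0 \<and> a ^ m = 1"])
  have least: "a ^ k \<noteq> 1" if "0 < k" "k < m" for k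
    using not_less_Least[of k "\<lambda>m. m > 0 \<and> a ^ m = 1"] that by (auto simp: m_def)
  have "of_nat m \<noteq> (0 :: 'a)"
  proof
    assume m0: "of_nat m = (0 :: 'a)"
    have "p dvd m"
    proof (rule ccontr)
      assume "\<not> p dvd m"
      then have "coprime p m" using assms(1) by (simp add: prime_imp_coprime)
      then obtain i j where "p * i = m * j + 1"
        using bezout_nat[of p m] prime_gt_0_nat[OF assms(1)] by auto
      then have "of_nat p * of_nat i = (of_nat m * of_nat j + 1 :: 'a)"
        by (metis of_nat_1 of_nat_add of_nat_mult)
      then show False using m0 assms(2) by simp
    qed
    then obtain k where k: "m = k * p" by (metis dvd_div_mult_self)
    have "(a ^ k) ^ p = 1" using m k by (simp add: power_mult)
    then have "a ^ k = 1" by (rule power_prime_characteristic_eq_1[OF assms(1,2)])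
    moreover have "0 < k" "k < m" using m k prime_gt_1_nat[OF assms(1)] by auto
    ultimately show False using least by blast
  qed
  then show ?thesis using m least by blast
qed

lemma finite_division_subring:
  fixes S :: "'a::division_ring set"
  assumes "finite S" "1 \<in> S" "\<And>x y. x \<in> S \<Longrightarrow> y \<in> S \<Longrightarrow> x - y \<in> S \<and> x * y \<in> S"
  shows "division_subring S"
  unfolding division_subring_def
proof (intro conjI ballI impI)
  fix x assume x: "x \<in> S" "x \<noteq> 0"
  have pow: "x ^ n \<in> S" for n by (induction n) (auto simp: assms x)
  then obtain n where n: "n > 0" "x ^ n = 1"
    using torsion_if_powers_finite[OF x(2) _ assms(1)] by (auto simp: torsion_def)
  then have "x * x ^ (n - 1) = 1" by (metis Suc_diff_1 power_Suc)
  then have "inverse x = x ^ (n - 1)" by (rule inverse_unique)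
  then show "inverse x \<in> S" using pow by simp
qed (use assms in auto)

lemma twisted_power:
  fixes a b l :: "'a::monoid_mult"
  assumes ba: "b * a = l * a * b" and l: "l * a = a * l" "l * b = b * l"
  shows "b ^ n * a ^ k = l ^ (n * k) * a ^ k * b ^ n"
proof -
  have 1: "b * a ^ k = l ^ k * a ^ k * b" for k
  proof (induction k)
    case (Suc k)
    have "b * a ^ Suc k = l * a * (b * a ^ k)" by (simp add: ba mult.assoc[symmetric])
    also have "\<dots> = l * (a * l ^ k) * a ^ k * b" by (simp add: Suc mult.assoc)
    also have "a * l ^ k = l ^ k * a" by (rule commute_power[symmetric, OF l(1)])
    finally show ?case by (simp add: mult.assoc)
  qed simp
  show ?thesis
  proof (induction n)
    case (Suc n)
    have "b ^ Suc n * a ^ k = b * l ^ (n * k) * a ^ k * b ^ n" by (simp add: Suc mult.assoc)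
    also have "b * l ^ (n * k) = l ^ (n * k) * b" by (rule commute_power[symmetric, OF l(2)])
    also have "l ^ (n * k) * b * a ^ k * b ^ n = l ^ (n * k) * (b * a ^ k) * b ^ n"
      by (simp add: mult.assoc)
    also have "b * a ^ k = l ^ k * a ^ k * b" by (rule 1)
    also have "l ^ (n * k) * (l ^ k * a ^ k * b) * b ^ n = l ^ (Suc n * k) * a ^ k * b ^ Suc n"
      by (simp add: power_add mult.assoc) (simp add: mult.assoc[symmetric] commute_power2)
    finally show ?case .
  qed simp
qed

lemma twisted_power_mult:
  fixes a b l :: "'a::monoid_mult"
  assumes ba: "b * a = l * a * b" and l: "l * a = a * l" "l * b = b * l"
  shows "(a * b) ^ n = l ^ (\<Sum>i<n. i) * a ^ n * b ^ n"
proof (induction n)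
  case (Suc n)
  have "(a * b) ^ Suc n = (a * b) ^ n * (a * b)" by (rule power_Suc2)
  also have "\<dots> = l ^ (\<Sum>i<n. i) * a ^ n * (b ^ n * a ^ 1) * b" by (simp add: Suc mult.assoc)
  also have "\<dots> = l ^ (\<Sum>i<n. i) * (a ^ n * l ^ n) * a * b ^ n * b"
    unfolding twisted_power[OF assms] by (simp add: mult.assoc)
  also have "a ^ n * l ^ n = l ^ n * a ^ n" by (rule commute_power2[symmetric, OF l(1)])
  finally show ?case by (simp add: power_add mult.assoc power_commutes)
qed simp

text \<open>If \<open>a\<^sup>r = 1\<close> then \<open>1 + a + \<dots> + a\<^sup>r\<^sup>-\<^sup>1 = 0\<close>, as \<open>a \<noteq> 1\<close>.  Conjugating by the powers of \<open>b\<close> replaces \<open>a\<close>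
  by the \<open>l\<^sup>n a\<close>, and the sum of all these equations is \<open>r = 0\<close>.  But in characteristic \<open>r\<close> there is no
  \<open>l \<noteq> 1\<close> with \<open>l\<^sup>r = 1\<close>.\<close>

lemma twisted_root_of_unity:
  fixes a b l :: "'a::division_ring"
  assumes r: "prime r" and l: "l ^ r = 1" "l \<noteq> 1" "l * a = a * l" "l * b = b * l"
    and ba: "b * a = l * a * b" and "b \<noteq> 0"
  shows "a ^ r \<noteq> 1"
proof
  assume ar: "a ^ r = 1"
  have "a \<noteq> 1" using ba l(2) \<open>b \<noteq> 0\<close> by auto
  moreover have "(a - 1) * (\<Sum>i<r. a ^ i) = 0" unfolding geometric_sum_ring by (simp add: ar)
  ultimately have sum0: "(\<Sum>i<r. a ^ i) = 0" by simp
  have conj: "(\<Sum>i<r. l ^ (n * i) * a ^ i) = 0" for n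
  proof -
    have "b ^ n * (\<Sum>i<r. a ^ i) = (\<Sum>i<r. l ^ (n * i) * a ^ i) * b ^ n"
      unfolding sum_distrib_left sum_distrib_right
      by (rule sum.cong) (auto simp: twisted_power[OF ba l(3,4)])
    then show ?thesis using sum0 \<open>b \<noteq> 0\<close> by simp
  qed
  have inner: "(\<Sum>n<r. l ^ (n * i)) = (if i = 0 then of_nat r else 0)" if "i < r" for i
  proof (cases "i = 0")
    case False
    have "l ^ i \<noteq> 1"
    proof
      assume "l ^ i = 1"
      moreover have "coprime i r"
        using that False r by (metis coprime_commute dvd_imp_le gr0I not_le prime_imp_coprime)
      ultimately show False using power_coprime_eq_1[OF _ l(1)] False l(2) by blast
    qed
    moreover have "(l ^ i - 1) * (\<Sum>n<r. (l ^ i) ^ n) = 0"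
      unfolding geometric_sum_ring
      using l(1) by (metis cancel_comm_monoid_add_class.diff_cancel mult.commute power_mult power_one)
    ultimately show ?thesis using False by (simp add: power_mult[symmetric] mult.commute)
  qed simp
  have "0 = (\<Sum>n<r. \<Sum>i<r. l ^ (n * i) * a ^ i)" by (simp add: conj)
  also have "\<dots> = (\<Sum>i<r. \<Sum>n<r. l ^ (n * i) * a ^ i)" by (rule sum.swap)
  also have "\<dots> = (\<Sum>i<r. (\<Sum>n<r. l ^ (n * i)) * a ^ i)" by (simp add: sum_distrib_right)
  also have "\<dots> = (\<Sum>i<r. if i = 0 then of_nat r else 0)" by (rule sum.cong) (auto simp: inner)
  also have "\<dots> = of_nat r" using prime_gt_0_nat[OF r] by simp
  finally have "of_nat r = (0 :: 'a)" by simp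
  then show False using power_prime_characteristic_eq_1[OF r _ l(1)] l(2) by blast
qed

lemma finite_field_generator:
  fixes Z :: "'a::division_ring set"
  assumes Z: "division_subring Z" "finite Z" "\<And>x y. x \<in> Z \<Longrightarrow> y \<in> Z \<Longrightarrow> x * y = y * x"
  shows "\<exists>g\<in>Z. g \<noteq> 0 \<and> (\<forall>x\<in>Z. x \<noteq> 0 \<longrightarrow> (\<exists>i. x = g ^ i))"
proof -
  note D = division_subringD[OF Z(1)]
  define R :: "'a ring" where "R = \<lparr>carrier = Z, monoid.mult = (*), one = 1, zero = 0, add = (+)\<rparr>"
  have "abelian_group R"
  proof (rule abelian_groupI)
    show "\<exists>y\<in>carrier R. y \<oplus>\<^bsub>R\<^esub> x = \<zero>\<^bsub>R\<^esub>" if "x \<in> carrier R" for x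
      using that D(5) by (intro bexI[of _ "- x"]) (auto simp: R_def)
  qed (auto simp: R_def D add_ac)
  moreover have "comm_monoid R"
    by (rule comm_monoidI) (auto simp: R_def D mult.assoc Z(3))
  ultimately have "cring R"
    by (rule cringI) (auto simp: R_def distrib_right)
  then interpret cring R .
  have "field R"
  proof (rule cring_fieldI2)
    show "\<exists>b\<in>carrier R. a \<otimes>\<^bsub>R\<^esub> b = \<one>\<^bsub>R\<^esub>" if "a \<in> carrier R" "a \<noteq> \<zero>\<^bsub>R\<^esub>" for a
      using that D(7) by (intro bexI[of _ "inverse a"]) (auto simp: R_def)
  qed (simp add: R_def)
  then interpret field R .
  have pow: "x [^]\<^bsub>R\<^esub> n = x ^ n" for x and n :: nat
    by (induction n) (auto simp: R_def nat_pow_def power_commutes)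
  obtain g where g: "g \<in> carrier (mult_of R)" "carrier (mult_of R) = {g [^]\<^bsub>R\<^esub> i | i::nat. i \<in> UNIV}"
    using finite_field_mult_group_has_gen Z(2) by (auto simp: R_def)
  have "g \<in> Z" "g \<noteq> 0" using g(1) by (auto simp: R_def)
  moreover have "\<exists>i. x = g ^ i" if "x \<in> Z" "x \<noteq> 0" for x
  proof -
    have "x \<in> carrier (mult_of R)" using that by (simp add: R_def)
    then show ?thesis using g(2) pow by auto
  qed
  ultimately show ?thesis by blast
qed

text \<open>As \<open>k\<close> is odd, every nonzero element of the field is a square or \<open>g\<^sup>k\<close> times a square.  If no
  \<open>1 + d\<^sup>2\<close> were of the second kind, adding 1 would preserve squares; then all integers, in
  particular \<open>-1\<close>, would be squares, and \<open>1 + d\<^sup>2 = 0\<close> would have a solution.\<close>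

lemma finite_field_conic:
  fixes Z :: "'a::division_ring set"
  assumes Z: "division_subring Z" "\<And>x y. x \<in> Z \<Longrightarrow> y \<in> Z \<Longrightarrow> x * y = y * x"
    and g: "g \<in> Z" "g \<noteq> 0" "\<And>x. x \<in> Z \<Longrightarrow> x \<noteq> 0 \<Longrightarrow> \<exists>i. x = g ^ i"
    and p: "p > 0" "of_nat p = (0 :: 'a)" and "odd k"
  shows "\<exists>c\<in>Z. \<exists>d\<in>Z. g ^ k * c ^ 2 = 1 + d ^ 2"
proof (rule ccontr)
  assume contra: "\<not> ?thesis"
  note D = division_subringD[OF Z(1)]
  have square: "\<exists>d\<in>Z. of_nat n = d ^ 2" for n
  proof (induction n)
    case 0
    show ?case by (rule bexI[of _ 0]) (auto simp: D)
  next
    case (Suc n)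
    then obtain d where d: "d \<in> Z" "of_nat n = d ^ 2" by auto
    show ?case
    proof (cases "1 + d ^ 2 = 0")
      case True
      then show ?thesis by (intro bexI[of _ 0]) (auto simp: D d(2))
    next
      case False
      then obtain i where i: "1 + d ^ 2 = g ^ i" using g(3)[of "1 + d ^ 2"] D d(1) by auto
      have "even i"
      proof (rule ccontr)
        assume "odd i"
        then obtain s where s: "i + k = 2 * s" using \<open>odd k\<close> by (metis evenE odd_even_add)
        define c where "c = g ^ s * inverse (g ^ k)"
        have comm: "inverse (g ^ k) * g ^ n = g ^ n * inverse (g ^ k)" for n
          by (rule commute_inverse) (simp flip: power_add add: add.commute)
        have "c ^ 2 = g ^ s * (inverse (g ^ k) * g ^ s) * inverse (g ^ k)"
          by (simp add: c_def power2_eq_square mult.assoc)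
        also have "\<dots> = g ^ (i + k) * inverse (g ^ k) * inverse (g ^ k)"
          unfolding comm s by (simp add: mult_2 power_add mult.assoc)
        also have "\<dots> = g ^ i * inverse (g ^ k)" using g(2) by (simp add: power_add mult.assoc)
        finally have "g ^ k * c ^ 2 = g ^ (i + k) * inverse (g ^ k)"
          by (simp add: mult.assoc[symmetric] power_add[symmetric] add.commute)
        also have "\<dots> = g ^ i" using g(2) by (simp add: power_add mult.assoc)
        finally have "g ^ k * c ^ 2 = 1 + d ^ 2" by (simp add: i)
        moreover have "c \<in> Z" by (simp add: c_def D g(1))
        ultimately show False using contra d(1) by blast
      qed
      then obtain s where "i = s * 2" by (metis dvd_div_mult_self)
      then have "of_nat (Suc n) = (g ^ s) ^ 2" using i d(2) by (simp add: power_mult)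
      then show ?thesis using D(8) g(1) by blast
    qed
  qed
  obtain d where d: "d \<in> Z" "of_nat (p - 1) = d ^ 2" using square by blast
  have "of_nat (p - 1) = (- 1 :: 'a)" using p by (simp add: of_nat_diff)
  then have "g ^ k * 0 ^ 2 = 1 + d ^ 2" unfolding d(2)[symmetric] by simp
  then show False using contra d(1) D(1) by blast
qed

text \<open>Wedderburn's theorem, by an argument of Herstein.  In a counterexample of least size all proper
  division subrings are commutative, so commuting with a common noncentral element is transitive.
  One finds \<open>a\<close>, \<open>b\<close> and a central \<open>l \<noteq> 1\<close> with \<open>b a = l a b\<close> whose \<open>r\<close>-th powers are central, for a
  prime \<open>r\<close>.  In the cyclic group of nonzero central elements, suitable powers of \<open>a\<^sup>r\<close> and \<open>b\<^sup>r\<close>, with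
  exponents prime to \<open>r\<close>, are equal.  Then the quotient of the corresponding powers of \<open>a\<close> and \<open>b\<close> is
  an \<open>r\<close>-th root of unity that some conjugation multiplies by a central element other than 1, which
  is impossible.  For \<open>r = 2\<close> a sign spoils this, and a rational point on a conic provides the root of
  unity instead.\<close>

theorem wedderburn:
  fixes D :: "'a::division_ring set"
  assumes "finite D" "division_subring D" "x0 \<in> D" "y0 \<in> D"
  shows "x0 * y0 = y0 * x0"
  using assms
proof (induction "card D" arbitrary: D x0 y0 rule: less_induct)
  case less
  note fin = less.prems(1) and ring = less.prems(2)
  note D = division_subringD[OF ring]
  define Z where "Z = relative_center D"
  have Zring: "division_subring Z" unfolding Z_def by (rule division_subring_relative_center[OF ring])
  note ZD = division_subringD[OF Zring]
  have Zsub: "Z \<subseteq> D" and Zcomm: "\<And>z x. z \<in> Z \<Longrightarrow> x \<in> D \<Longrightarrow> z * x = x * z"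
    by (auto simp: Z_def relative_center_def)
  obtain n :: nat where "n > 0" "of_nat n = (0 :: 'a)"
  proof -
    have "\<not> inj (of_nat :: nat \<Rightarrow> 'a)"
      using D(9) fin by (meson finite_imageD finite_subset image_subsetI infinite_UNIV_nat)
    then obtain i j :: nat where ij: "i < j" "of_nat i = (of_nat j :: 'a)"
      unfolding inj_def by (metis linorder_neqE_nat)
    then have "of_nat (j - i) = (0 :: 'a)" by (simp add: of_nat_diff)
    then show thesis using that[of "j - i"] ij(1) by auto
  qed
  then obtain p where p: "prime p" "of_nat p = (0 :: 'a)" using prime_characteristic by blast
  have tors: "torsion x" if "x \<in> D" "x \<noteq> 0" for x
    using torsion_if_powers_finite[OF that(2) _ fin] D(8) that(1) by blast
  have centralizer: "x * y = y * x"
    if u: "u \<in> D" "u \<notin> Z" and "x \<in> D" "y \<in> D" "x * u = u * x" "y * u = u * y" for u x y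
  proof -
    define C where "C = {z \<in> D. \<forall>w\<in>{u}. z * w = w * z}"
    have "division_subring C" unfolding C_def by (rule division_subring_commutant[OF ring])
    moreover have "C \<subset> D"     proof -
      obtain z where "z \<in> D" "u * z \<noteq> z * u" using u by (auto simp: Z_def relative_center_def)
      then have "z \<in> D - C" by (auto simp: C_def)
      moreover have "C \<subseteq> D" by (auto simp: C_def)
      ultimately show ?thesis by blast
    qed
    moreover have "x \<in> C" "y \<in> C" using that by (auto simp: C_def)
    ultimately show ?thesis using less.hyps[of C x y] fin psubset_card_mono[of D C] finite_subset[of C D] by blast
  qed
  show ?case
  proof (rule ccontr)
    assume noncomm: "x0 * y0 \<noteq> y0 * x0"
    have x0: "x0 \<in> D" "x0 \<notin> Z" using less.prems(3,4) noncomm Zcomm by auto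
    \<comment> \<open>The least exponent that makes some noncentral element central; it is prime.\<close>
    define P where "P r \<longleftrightarrow> r > 0 \<and> (\<exists>a\<in>D. a \<notin> Z \<and> a ^ r \<in> Z)" for r :: nat
    define r where "r = (LEAST r. P r)"
    have "\<exists>r. P r"
      using tors[OF x0(1)] x0 ZD(1,2) unfolding P_def torsion_def by metis
    then have "P r" unfolding r_def by (rule LeastI_ex)
    then obtain a where a: "r > 0" "a \<in> D" "a \<notin> Z" "a ^ r \<in> Z" by (auto simp: P_def)
    have least: "w ^ s \<notin> Z" if "w \<in> D" "w \<notin> Z" "0 < s" "s < r" for w s
      using not_less_Least[of s P] that by (auto simp: r_def P_def)
    have a0: "a \<noteq> 0" using a(3) ZD(1) by auto
    have r: "prime r" unfolding prime_nat_iff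
    proof (intro conjI allI impI)
      show "1 < r" using a by (metis One_nat_def Suc_lessI power_one_right)
      fix d assume dvd: "d dvd r"
      obtain e where e: "r = d * e" using dvd by (rule dvdE)
      show "d = 1 \<or> d = r"
      proof (rule ccontr)
        assume d: "\<not> (d = 1 \<or> d = r)"
        have "0 < d" "0 < e" using a(1) e by (auto intro: Nat.gr0I)
        moreover have "d < r" using d dvd a(1) by (simp add: dvd_imp_le le_neq_implies_less)
        moreover have "e < r" using e d \<open>0 < d\<close> \<open>0 < e\<close> by (cases "d = 1") auto
        ultimately have "a ^ d \<notin> Z" "(a ^ d) ^ e \<notin> Z"
          using least[OF a(2,3)] least[of "a ^ d" e] D(8)[OF a(2)] by auto
        then show False using a(4) e by (simp add: power_mult)
      qed
    qed
    obtain y where y: "y \<in> D" "y * a \<noteq> a * y"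
      using a(2,3) unfolding Z_def relative_center_def by force
    obtain m where m: "m > 0" "a ^ m = 1" "\<And>k. 0 < k \<Longrightarrow> k < m \<Longrightarrow> a ^ k \<noteq> 1" "of_nat m \<noteq> (0 :: 'a)"
      using torsion_order[OF p tors[OF a(2) a0]] by blast
    obtain x j where x: "x \<in> D" "x \<noteq> 0" "x * a = a ^ j * x" "a ^ j \<noteq> a"
      using torsion_normalized[OF ring a(2) y(1) m y(2)] by blast
    have xa: "x * a \<noteq> a * x" using x by auto
    have xZ: "x \<notin> Z" using xa Zcomm a(2) by blast
    have rj: "\<not> r dvd j"
    proof
      assume "r dvd j"
      then obtain k where "j = r * k" by (rule dvdE)
      then have "a ^ j \<in> Z" using ZD(8)[OF a(4)] by (simp add: power_mult)
      then have "x * a = x * a ^ j" using x(1,3) Zcomm by simp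
      then show False using x(2,4) by simp
    qed
    \<comment> \<open>Conjugation by \<open>x\<close> raises \<open>a\<close> to the power \<open>j\<close>, so by Fermat's little theorem conjugation by
      \<open>x\<^sup>r\<^sup>-\<^sup>1\<close> multiplies \<open>a\<close> by a power of the central element \<open>a\<^sup>r\<close>.\<close>
    define b where "b = x ^ (r - 1)"
    have r1: "1 < r" using prime_gt_1_nat[OF r] .
    have b: "b \<in> D" "b \<notin> Z" "b \<noteq> 0"
      using least[OF x(1) xZ, of "r - 1"] r1 D(8) x(1,2) by (auto simp: b_def)
    have xak: "x * a ^ k = a ^ (j * k) * x" for k
    proof (induction k)
      case (Suc k)
      have "x * a ^ Suc k = a ^ j * (x * a ^ k)" by (simp add: x(3) mult.assoc[symmetric])
      then show ?case by (simp add: Suc power_add mult.assoc)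
    qed simp
    have xna: "x ^ n * a = a ^ (j ^ n) * x ^ n" for n
    proof (induction n)
      case (Suc n)
      have "x ^ Suc n * a = x * a ^ (j ^ n) * x ^ n" by (simp add: Suc mult.assoc)
      then show ?case by (simp add: xak mult.assoc)
    qed simp
    have "[j ^ (r - 1) = 1] (mod r)" using fermat_theorem[OF r rj] .
    moreover have j1: "j ^ (r - 1) \<ge> 1" using rj by (cases "j = 0") auto
    ultimately have "r dvd j ^ (r - 1) - 1" by (simp add: cong_altdef_nat)
    then obtain u where "j ^ (r - 1) - 1 = r * u" by (rule dvdE)
    then have u: "j ^ (r - 1) = 1 + r * u" using j1 by simp
    define l where "l = (a ^ r) ^ u"
    have lZ: "l \<in> Z" unfolding l_def by (rule ZD(8)[OF a(4)])
    have ba: "b * a = l * a * b"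
    proof -
      have "a ^ (1 + r * u) = a ^ (r * u) * a ^ 1"
        unfolding power_add[symmetric] by (rule arg_cong[OF add.commute])
      then show ?thesis unfolding b_def xna u l_def by (simp add: power_mult)
    qed
    have la: "l * a = a * l" and lb: "l * b = b * l" using Zcomm[OF lZ] a(2) b(1) by auto
    have ab: "b * a \<noteq> a * b"
    proof
      assume *: "b * a = a * b"
      have "x * b = b * x" unfolding b_def by (rule commute_power[symmetric]) simp
      then show False using centralizer[OF b(1,2) x(1) a(2)] * xa by simp
    qed
    have l1: "l \<noteq> 1" using ab ba by auto
    have "l ^ r * (a ^ r * b) = a ^ r * b"
      using twisted_power[OF ba la lb, of 1 r] Zcomm[OF a(4) b(1)] by (simp add: mult.assoc)
    then have lr: "l ^ r = 1" using a0 b(3) by simp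
    have "b ^ r * a = a * b ^ r" using twisted_power[OF ba la lb, of r 1] lr by simp
    then have br: "b ^ r \<in> Z"
      using centralizer[of "b ^ r" a b] ab a(2) b(1) D(8) commute_power[of b b r] by fastforce
    obtain g where g: "g \<in> Z" "g \<noteq> 0" "\<And>x. x \<in> Z \<Longrightarrow> x \<noteq> 0 \<Longrightarrow> \<exists>i. x = g ^ i"
      using finite_field_generator[OF Zring finite_subset[OF Zsub fin]] Zcomm Zsub by blast
    obtain m n where mn: "a ^ r = g ^ m" "b ^ r = g ^ n"
      using g(3)[OF a(4)] g(3)[OF br] a0 b(3) by auto
    have no_root: "w ^ r \<noteq> 1"
      if "w \<in> D" "v \<in> D" "v \<noteq> 0" "v * w = c * w * v" "c \<in> Z" "c \<noteq> 1" "c ^ r = 1" for v w c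
      using twisted_root_of_unity[OF r that(7,6) _ _ that(4,3)] Zcomm[OF that(5)] that(1,2) by blast
    have not_dvd: "\<not> r dvd k"
      if w: "w \<in> D" "v \<in> D" "v \<noteq> 0" "v * w = c * w * v" "c \<in> Z" "c \<noteq> 1" "c ^ r = 1"
        and k: "w ^ r = g ^ k" for v w c k
    proof
      assume "r dvd k"
      then obtain s where s: "k = r * s" by (rule dvdE)
      define h where "h = inverse (g ^ s)"
      have hZ: "h \<in> Z" unfolding h_def by (intro ZD g)
      have wh: "w * h = h * w" using Zcomm[OF hZ w(1)] by simp
      have "(w * h) ^ r = w ^ r * h ^ r" by (rule power_mult_distrib_commute[OF wh])
      also have "h ^ r = inverse (g ^ k)" by (simp add: h_def s power_mult mult.commute power_inverse flip: power_mult)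
      finally have "(w * h) ^ r = 1" using g(2) k by simp
      moreover have "v * (w * h) = c * (w * h) * v"
      proof -
        have "v * (w * h) = c * w * (v * h)" by (simp add: w(4) mult.assoc[symmetric])
        also have "v * h = h * v" using Zcomm[OF hZ w(2)] by simp
        finally show ?thesis by (simp add: mult.assoc)
      qed
      moreover have "w * h \<in> D" using hZ Zsub w(1) D(6) by blast
      ultimately show False using no_root[of "w * h" v c] w by blast
    qed
    have rm: "\<not> r dvd m" using not_dvd[OF a(2) b(1,3) ba lZ l1 lr mn(1)] .
    have "inverse l * b * a = inverse l * l * a * b" by (simp add: ba mult.assoc)
    moreover have "l \<noteq> 0" using lr r1 by (auto simp: power_0_left)
    ultimately have "a * b = inverse l * b * a" by (simp add: mult.assoc)
    then have rn: "\<not> r dvd n"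
      using not_dvd[OF b(1) a(2) a0 _ ZD(7)[OF lZ] _ _ mn(2)] l1 lr \<open>l \<noteq> 0\<close>
      by (metis inverse_1 inverse_inverse_eq power_inverse)
    \<comment> \<open>Powers of \<open>a\<close> and \<open>b\<close> with a common \<open>r\<close>-th power, which still do not commute because
      neither exponent is divisible by \<open>r\<close>.\<close>
    define a1 b1 c where "a1 = a ^ n" and "b1 = b ^ m" and "c = l ^ (m * n)"
    have a1: "a1 \<in> D" "a1 \<noteq> 0" and b1: "b1 \<in> D" "b1 \<noteq> 0"
      using a(2) a0 b D(8) by (auto simp: a1_def b1_def)
    have cZ: "c \<in> Z" unfolding c_def by (rule ZD(8)[OF lZ])
    have ba1: "b1 * a1 = c * a1 * b1"
      unfolding a1_def b1_def c_def by (rule twisted_power[OF ba la lb])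
    have cr: "c ^ r = 1" unfolding c_def by (metis lr mult.commute power_mult power_one)
    have c1: "c \<noteq> 1"
    proof
      assume "c = 1"
      have "coprime (m * n) r" using rm rn r by (metis coprime_commute prime_dvd_mult_iff prime_imp_coprime)
      moreover have "m * n > 0" using rm rn by (auto intro: Nat.gr0I)
      ultimately show False using power_coprime_eq_1[of l "m * n" r] \<open>c = 1\<close> lr l1 by (simp add: c_def)
    qed
    have a1r: "a1 ^ r = g ^ (m * n)" and b1r: "b1 ^ r = g ^ (m * n)"
      unfolding a1_def b1_def by (metis mn mult.commute power_mult)+
    define w where "w = inverse a1 * b1"
    have wD: "w \<in> D" unfolding w_def by (intro D a1 b1)
    have w0: "w \<noteq> 0" using a1(2) b1(2) by (simp add: w_def)
    have aw: "a1 * w = b1" using a1(2) by (simp add: w_def mult.assoc[symmetric])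
    have ca: "c * a1 = a1 * c" and cw: "c * w = w * c" using Zcomm[OF cZ] a1 wD by auto
    have "w * a1 = inverse a1 * (c * a1) * b1" by (simp add: w_def ba1 mult.assoc)
    also have "\<dots> = c * b1" unfolding ca using a1(2) by (simp add: mult.assoc[symmetric])
    also have "\<dots> = c * a1 * w" by (simp add: aw mult.assoc)
    finally have wa: "w * a1 = c * a1 * w" .
    have "g ^ (m * n) = c ^ (\<Sum>i<r. i) * g ^ (m * n) * w ^ r"
      using twisted_power_mult[OF wa ca cw, of r] by (simp add: aw a1r b1r)
    also have "c ^ (\<Sum>i<r. i) * g ^ (m * n) = g ^ (m * n) * c ^ (\<Sum>i<r. i)"
      using Zcomm[OF ZD(8)[OF cZ]] ZD(8)[OF g(1)] Zsub by blast
    finally have wr: "c ^ (\<Sum>i<r. i) * w ^ r = 1" using g(2) by (simp add: mult.assoc)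
    show False
    proof (cases "r = 2")
      case False
      then have "odd r" using r prime_odd_nat[of r] r1 by auto
      then obtain s where s: "r = 2 * s + 1" by (elim oddE)
      have "(\<Sum>i<r. i) = r * s"
        unfolding s by (induction s) (auto simp: algebra_simps)
      then have "w ^ r = 1" using wr cr by (simp add: power_mult)
      moreover have "a1 * w = inverse c * w * a1"
      proof -
        have "c \<noteq> 0" using cr r1 by (auto simp: power_0_left)
        then show ?thesis by (simp add: wa mult.assoc) (simp add: mult.assoc[symmetric])
      qed
      ultimately show False
        using no_root[OF wD a1 _ ZD(7)[OF cZ]] c1 cr
        by (metis inverse_1 inverse_inverse_eq power_inverse)
    next
      case True
      \<comment> \<open>Now \<open>w\<^sup>2 = -1\<close> and \<open>w\<close> anticommutes with \<open>a1\<close>; the element \<open>q = d a1 + e w\<close> squares to 1 but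
        anticommutes with \<open>a1 w\<close>.\<close>
      have "(c - 1) * (c + 1) = 0" using cr True by (simp add: algebra_simps power2_eq_square)
      then have c: "c = - 1" using c1 by (simp add: eq_neg_iff_add_eq_0)
      have "(\<Sum>i<r. i) = 1" unfolding True by (simp add: numeral_2_eq_2)
      then have w2: "w * w = - 1" using wr True c by (simp add: power2_eq_square minus_equation_iff)
      have wa': "w * a1 = - (a1 * w)" using wa c by simp
      have "odd (m * n)" using rm rn True by simp
      then obtain d e where de: "d \<in> Z" "e \<in> Z" "g ^ (m * n) * d ^ 2 = 1 + e ^ 2"
        using finite_field_conic[OF Zring _ g _ p(2), of "m * n"] prime_gt_0_nat[OF p(1)] Zcomm Zsub
        by (metis subset_iff)
      define q where "q = d * a1 + e * w"
      have dc: "d * z = z * d" "e * z = z * e" if "z \<in> D" for z using Zcomm de that by auto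
      have "q * q = d * (a1 * d) * a1 + d * (a1 * e) * w + e * (w * d) * a1 + e * (w * e) * w"
        by (simp add: q_def algebra_simps)
      also have "\<dots> = d * d * (a1 * a1) + d * e * (a1 * w) + e * d * (w * a1) + e * e * (w * w)"
        unfolding dc(1)[OF a1(1), symmetric] dc(2)[OF a1(1), symmetric]
          dc(1)[OF wD, symmetric] dc(2)[OF wD, symmetric] by (simp add: mult.assoc)
      also have "e * d = d * e" using dc(2)[of d] de(1) Zsub by auto
      also have "a1 * a1 = g ^ (m * n)" using a1r True by (simp add: power2_eq_square)
      also have "d * d * g ^ (m * n) = g ^ (m * n) * d ^ 2"
        using Zcomm[OF ZD(8)[OF g(1)], of "d * d"] D(6) de(1) Zsub by (auto simp: power2_eq_square)
      finally have "q * q = 1" unfolding de(3) by (simp add: wa' w2 power2_eq_square)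
      then have q2: "q ^ r = 1" using True by (simp add: power2_eq_square)
      define v where "v = a1 * w"
      have v: "v \<in> D" "v \<noteq> 0" using a1 wD w0 D(6) by (auto simp: v_def)
      have va: "v * a1 = - (a1 * v)" by (simp add: v_def mult.assoc wa')
      have vw: "v * w = - (w * v)" by (simp add: v_def mult.assoc[symmetric] wa')
      have "v * q = d * (v * a1) + e * (v * w)"
        using dc[OF v(1)] by (simp add: q_def distrib_left mult.assoc[symmetric])
      then have "v * q = c * q * v" by (simp add: va vw c q_def algebra_simps)
      moreover have "q \<in> D" unfolding q_def using de Zsub by (intro D a1 wD) auto
      ultimately show False using no_root[OF _ v _ cZ c1 cr] q2 by blast
    qed
  qed
qed

text \<open>Jacobson's theorem, for division rings.  An element \<open>y\<close> that normalizes but does not centralize the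
  finite group generated by \<open>a\<close> spans together with \<open>a\<close> a finite ring, which Wedderburn's theorem
  forbids.\<close>

theorem jacobson_torsion_commutative:
  fixes D :: "'a::division_ring set"
  assumes p: "prime p" "of_nat p = (0 :: 'a)" and D: "division_subring D"
    and tors: "\<And>x. x \<in> D \<Longrightarrow> x \<noteq> 0 \<Longrightarrow> torsion x" and xy: "x \<in> D" "a \<in> D"
  shows "x * a = a * x"
proof (rule ccontr)
  assume xa: "x * a \<noteq> a * x"
  then have a0: "a \<noteq> 0" by auto
  have p0: "p > 0" by (rule prime_gt_0_nat[OF p(1)])
  obtain m where m: "m > 0" "a ^ m = 1" "\<And>k. 0 < k \<Longrightarrow> k < m \<Longrightarrow> a ^ k \<noteq> 1" "of_nat m \<noteq> (0 :: 'a)"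
    using torsion_order[OF p tors[OF xy(2) a0]] by blast
  obtain y j where y: "y \<in> D" "y \<noteq> 0" "y * a = a ^ j * y" "a ^ j \<noteq> a"
    using torsion_normalized[OF D xy(2,1) m xa] by blast
  have yak: "y * a ^ k = a ^ (j * k) * y" for k
  proof (induction k)
    case (Suc k)
    have "y * a ^ Suc k = a ^ j * (y * a ^ k)" by (simp add: y(3) mult.assoc[symmetric])
    then show ?case by (simp add: Suc power_add mult.assoc)
  qed simp
  have yna: "\<exists>i. y ^ n * a ^ k = a ^ i * y ^ n" for n k
  proof (induction n)
    case (Suc n)
    then obtain i where "y ^ n * a ^ k = a ^ i * y ^ n" by blast
    then have "y ^ Suc n * a ^ k = a ^ (j * i) * y ^ Suc n"
      by (simp add: mult.assoc) (simp add: yak mult.assoc[symmetric])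
    then show ?case by blast
  qed (auto intro: exI[of _ k])
  define G where "G = (\<lambda>(u, v). u * v) ` (range (\<lambda>n::nat. a ^ n) \<times> range (\<lambda>n::nat. y ^ n))"
  have fin: "finite G"
    unfolding G_def
    using tors xy(2) a0 y(1,2) by (intro finite_imageI finite_cartesian_product torsion_powers_finite) auto
  have G: "a ^ i * y ^ j \<in> G" for i j unfolding G_def by auto
  have mult: "g * h \<in> G" if "g \<in> G" "h \<in> G" for g h
  proof -
    obtain i j k l where gh: "g = a ^ i * y ^ j" "h = a ^ k * y ^ l"
      using \<open>g \<in> G\<close> \<open>h \<in> G\<close> by (auto simp: G_def)
    obtain s where s: "y ^ j * a ^ k = a ^ s * y ^ j" using yna by blast
    have "g * h = a ^ i * (y ^ j * a ^ k) * y ^ l" by (simp add: gh mult.assoc)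
    also have "\<dots> = a ^ (i + s) * y ^ (j + l)" by (simp add: s power_add mult.assoc)
    finally show ?thesis using G by simp
  qed
  have base: "a \<in> additive_span G" "y \<in> additive_span G" "1 \<in> additive_span G"
    using G[of 1 0] G[of 0 1] G[of 0 0] fin by (auto intro: additive_span_base)
  have "division_subring (additive_span G)"
  proof (rule finite_division_subring)
    fix u v assume uv: "u \<in> additive_span G" "v \<in> additive_span G"
    show "u - v \<in> additive_span G \<and> u * v \<in> additive_span G"
      using additive_span_add[OF uv(1) additive_span_uminus[OF p0 p(2) uv(2)]]
        additive_span_mult[OF fin mult uv] by simp
  qed (use base finite_additive_span[OF p0 p(2) fin] in auto)
  then have "y * a = a * y"
    using wedderburn[OF finite_additive_span[OF p0 p(2) fin]] base by blast
  then show False using y by simp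
qed

section \<open>Valuation rings\<close>

text \<open>Subrings are plain sets here, as they have to be ordered by inclusion for Zorn's lemma.\<close>

definition unital_subring :: "'k::field set \<Rightarrow> bool" where
  "unital_subring A \<longleftrightarrow> 1 \<in> A \<and> (\<forall>x\<in>A. \<forall>y\<in>A. x - y \<in> A \<and> x * y \<in> A)"

lemma unital_subringD:
  assumes "unital_subring A"
  shows "0 \<in> A" "1 \<in> A" "x \<in> A \<Longrightarrow> y \<in> A \<Longrightarrow> x + y \<in> A" "x \<in> A \<Longrightarrow> y \<in> A \<Longrightarrow> x - y \<in> A"
    "x \<in> A \<Longrightarrow> - x \<in> A" "x \<in> A \<Longrightarrow> y \<in> A \<Longrightarrow> x * y \<in> A" "x \<in> A \<Longrightarrow> x ^ n \<in> A" "of_int m \<in> A"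
proof -
  show 1: "1 \<in> A" and diff: "x \<in> A \<Longrightarrow> y \<in> A \<Longrightarrow> x - y \<in> A"
    and mult: "x \<in> A \<Longrightarrow> y \<in> A \<Longrightarrow> x * y \<in> A" for x y
    using assms by (auto simp: unital_subring_def)
  show 0: "0 \<in> A" using diff[OF 1 1] by simp
  show uminus: "x \<in> A \<Longrightarrow> - x \<in> A" for x using diff[OF 0, of x] by simp
  show add: "x \<in> A \<Longrightarrow> y \<in> A \<Longrightarrow> x + y \<in> A" for x y using diff[OF _ uminus, of x y] by simp
  show "x \<in> A \<Longrightarrow> x ^ n \<in> A" by (induction n) (auto intro: 1 mult)
  have "of_nat n \<in> A" for n by (induction n) (auto intro: 0 1 add)
  then show "of_int m \<in> A" by (cases m) (auto simp del: of_nat_Suc intro: uminus)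
qed

lemma unital_subring_sum:
  assumes "unital_subring A" "\<And>i. i \<in> I \<Longrightarrow> f i \<in> A"
  shows "sum f I \<in> A"
  using assms(2) by (induction I rule: infinite_finite_induct)
    (auto intro: unital_subringD[OF assms(1)])

definition adjoin :: "'k::field set \<Rightarrow> 'k \<Rightarrow> 'k set" where
  "adjoin A z = {poly p z | p. \<forall>i. Polynomial.coeff p i \<in> A}"

lemma unital_subring_adjoin:
  assumes A: "unital_subring A"
  shows "unital_subring (adjoin A z)" "A \<subseteq> adjoin A z" "z \<in> adjoin A z"
proof -
  note D = unital_subringD[OF A]
  show sub: "A \<subseteq> adjoin A z"
  proof
    fix a assume "a \<in> A"
    then have "\<forall>i. Polynomial.coeff [:a:] i \<in> A" using D(1) by (simp add: Polynomial.coeff_pCons split: nat.split)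
    then show "a \<in> adjoin A z" unfolding adjoin_def by (intro CollectI exI[of _ "[:a:]"]) simp
  qed
  have "\<forall>i. Polynomial.coeff [:0, 1:] i \<in> A" using D(1,2) by (simp add: Polynomial.coeff_pCons split: nat.split)
  then show "z \<in> adjoin A z" unfolding adjoin_def by (intro CollectI exI[of _ "[:0, 1:]"]) simp
  show "unital_subring (adjoin A z)"
    unfolding unital_subring_def
  proof (intro conjI ballI)
    show "1 \<in> adjoin A z" using sub D(2) by blast
    fix x y assume "x \<in> adjoin A z" "y \<in> adjoin A z"
    then obtain p q where pq: "x = poly p z" "y = poly q z" "\<And>i. Polynomial.coeff p i \<in> A" "\<And>i. Polynomial.coeff q i \<in> A"
      by (auto simp: adjoin_def)
    show "x - y \<in> adjoin A z"
      unfolding adjoin_def using pq D(4) by (intro CollectI exI[of _ "p - q"]) auto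
    have "Polynomial.coeff (p * q) i \<in> A" for i
      unfolding Polynomial.coeff_mult using pq D(6) by (intro unital_subring_sum[OF A]) auto
    then show "x * y \<in> adjoin A z"
      unfolding adjoin_def using pq by (intro CollectI exI[of _ "p * q"]) auto
  qed
qed

lemma unital_subring_Ints: "unital_subring (\<int> :: 'k::field set)"
  by (auto simp: unital_subring_def)

text \<open>A subring \<open>A\<close> that is maximal among those containing \<open>t\<close> but not \<open>1/t\<close> is a valuation
  ring.  First, inverting \<open>1 + ta\<close> does not make \<open>t\<close> invertible, so the units of \<open>A\<close> contain \<open>1 + tA\<close>.
  If neither \<open>z\<close> nor \<open>1/z\<close> were in \<open>A\<close>, then \<open>1\<close> would be a polynomial with coefficients in \<open>tA\<close> both
  in \<open>z\<close> and in \<open>1/z\<close>; with the relation of smaller degree the degree of the other one can be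
  lowered.\<close>

lemma valuation_ring_exists:
  fixes t :: "'k::field"
  assumes A0: "unital_subring A0" "t \<in> A0" "inverse t \<notin> A0"
  shows "\<exists>A. unital_subring A \<and> t \<in> A \<and> inverse t \<notin> A \<and> (\<forall>x. x \<in> A \<or> inverse x \<in> A)"
proof -
  have t0: "t \<noteq> 0" using assms unital_subringD(1)[OF A0(1)] by auto
  define S where "S = {A. unital_subring A \<and> t \<in> A \<and> inverse t \<notin> A}"
  have "\<exists>A\<in>S. \<forall>X\<in>S. A \<subseteq> X \<longrightarrow> X = A"
  proof (rule subset_Zorn_nonempty)
    show "S \<noteq> {}" using A0 by (auto simp: S_def)
    fix C assume C: "C \<noteq> {}" "subset.chain S C"
    then have mem: "X \<in> S" if "X \<in> C" for X using that by (auto simp: subset.chain_def)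
    have "unital_subring (\<Union>C)"
      unfolding unital_subring_def
    proof (intro conjI ballI)
      show "1 \<in> \<Union>C" using C(1) mem by (auto simp: S_def unital_subring_def)
      fix x y assume "x \<in> \<Union>C" "y \<in> \<Union>C"
      then obtain X Y where XY: "X \<in> C" "Y \<in> C" "x \<in> X" "y \<in> Y" by blast
      then have "X \<subseteq> Y \<or> Y \<subseteq> X" using C(2) by (auto simp: subset.chain_def)
      then obtain W where "W \<in> C" "x \<in> W" "y \<in> W" using XY by blast
      then show "x - y \<in> \<Union>C" "x * y \<in> \<Union>C" using mem[of W] by (auto simp: S_def unital_subring_def)
    qed
    then show "\<Union>C \<in> S" using C(1) mem by (auto simp: S_def)
  qed
  then obtain A where A: "unital_subring A" "t \<in> A" "inverse t \<notin> A"
      and max: "\<And>X. unital_subring X \<Longrightarrow> inverse t \<notin> X \<Longrightarrow> A \<subseteq> X \<Longrightarrow> X = A"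
    unfolding S_def by blast
  note D = unital_subringD[OF A(1)]
  have not1: "t * a \<noteq> 1" if "a \<in> A" for a
    using that A(3) inverse_unique by blast
  have unit: "inverse (1 + t * a) \<in> A" if a: "a \<in> A" for a
  proof -
    define u where "u = 1 + t * a"
    have uA: "u \<in> A" unfolding u_def by (intro D A(2) a)
    have u0: "u \<noteq> 0"
      using not1[OF D(5)[OF a]] by (auto simp: u_def add_eq_0_iff)
    define X where "X = {b * inverse u ^ n | b n. b \<in> A}"
    have X: "b * inverse u ^ n \<in> X" if "b \<in> A" for b n using that by (auto simp: X_def)
    have "unital_subring X"
      unfolding unital_subring_def
    proof (intro conjI ballI)
      show "1 \<in> X" using X[OF D(2), of 0] by simp
      fix x y assume "x \<in> X" "y \<in> X"
      then obtain b c n m where bc: "b \<in> A" "c \<in> A" "x = b * inverse u ^ n" "y = c * inverse u ^ m"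
        by (auto simp: X_def)
      have "x - y = (b * u ^ m - c * u ^ n) * inverse u ^ (n + m)"
        using u0 by (simp add: bc power_add field_simps)
      moreover have "b * u ^ m - c * u ^ n \<in> A" by (intro D bc uA)
      ultimately show "x - y \<in> X" using X by metis
      have "x * y = (b * c) * inverse u ^ (n + m)" by (simp add: bc power_add)
      then show "x * y \<in> X" using X[OF D(6)[OF bc(1,2)]] by metis
    qed
    moreover have "A \<subseteq> X" using X[of _ 0] by auto
    moreover have "inverse t \<notin> X"
    proof
      assume "inverse t \<in> X"
      then obtain b n where b: "b \<in> A" "inverse t = b * inverse u ^ n" by (auto simp: X_def)
      have "\<exists>e\<in>A. u ^ n = 1 + t * e"
      proof (induction n)
        case (Suc n)
        then obtain e where e: "e \<in> A" "u ^ n = 1 + t * e" by blast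
        have "u ^ Suc n = 1 + t * (a + e + t * a * e)"
          by (simp add: e(2)) (simp add: u_def algebra_simps)
        moreover have "a + e + t * a * e \<in> A" by (intro D a e(1) A(2))
        ultimately show ?case by blast
      qed (auto intro: bexI[of _ 0] D)
      then obtain e where e: "e \<in> A" "u ^ n = 1 + t * e" by blast
      have "u ^ n = t * b" using b(2) u0 t0 by (simp add: field_simps)
      then have "t * (b - e) = 1" using e(2) by (simp add: algebra_simps)
      then show False using not1 D(4)[OF b(1) e(1)] by blast
    qed
    ultimately have "X = A" using max by blast
    then show ?thesis using X[OF D(2), of 1] by (simp add: u_def)
  qed
  \<comment> \<open>Polynomials in \<open>z\<close> of degree less than \<open>n\<close> with coefficients in \<open>tA\<close>.\<close>
  define M where "M z n = {x. \<exists>c. (\<forall>i. c i \<in> A) \<and> x = (\<Sum>i<n. t * c i * z ^ i)}" for z and n :: nat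
  have M_add: "x + y \<in> M z n" if xy: "x \<in> M z n" "y \<in> M z n" for x y z n
  proof -
    obtain c d where "\<forall>i. c i \<in> A" "\<forall>i. d i \<in> A" "x = (\<Sum>i<n. t * c i * z ^ i)" "y = (\<Sum>i<n. t * d i * z ^ i)"
      using xy unfolding M_def by blast
    then show ?thesis unfolding M_def
      using D(3) by (intro CollectI exI[of _ "\<lambda>i. c i + d i"]) (auto simp: algebra_simps sum.distrib)
  qed
  have M_monom: "t * a * z ^ j \<in> M z n" if "a \<in> A" "j < n" for a z j n
  proof -
    have "(\<Sum>i<n. t * (if i = j then a else 0) * z ^ i) = (\<Sum>i<n. if i = j then t * a * z ^ j else 0)"
      by (rule sum.cong) auto
    then show ?thesis unfolding M_def
      using that D(1) by (intro CollectI exI[of _ "\<lambda>i. if i = j then a else 0"]) auto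
  qed
  have M_sum: "sum f K \<in> M z n" if "\<And>i. i \<in> K \<Longrightarrow> f i \<in> M z n" for f and K :: "nat set" and z n
  proof -
    have "0 \<in> M z n" unfolding M_def using D(1) by (intro CollectI exI[of _ "\<lambda>_. 0"]) auto
    then show ?thesis using that by (induction K rule: infinite_finite_induct) (auto intro: M_add)
  qed
  have ex: "\<exists>n. 1 \<in> M z n" if "z \<notin> A" for z
  proof -
    have "inverse t \<in> adjoin A z"
      using max[OF unital_subring_adjoin(1)[OF A(1)] _ unital_subring_adjoin(2)[OF A(1)]]
        unital_subring_adjoin(3)[OF A(1)] that by blast
    then obtain p where p: "inverse t = poly p z" "\<And>i. Polynomial.coeff p i \<in> A" by (auto simp: adjoin_def)
    have "1 = t * poly p z" using p(1) t0 by (metis right_inverse)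
    also have "\<dots> = (\<Sum>i<Suc (degree p). t * Polynomial.coeff p i * z ^ i)"
      unfolding poly_altdef lessThan_Suc_atMost sum_distrib_left by (simp add: mult.assoc)
    finally show ?thesis unfolding M_def using p(2) by blast
  qed
  \<comment> \<open>The relation for \<open>1/z\<close> expresses the top power of \<open>z\<close> in the other relation by lower ones.\<close>
  have reduce: "\<exists>k<n. 1 \<in> M z k" if z0: "z \<noteq> 0" and n: "1 \<in> M z n" and m: "1 \<in> M (inverse z) m" "m \<le> n" for z n m
  proof -
    obtain b where b: "\<And>i. b i \<in> A" "1 = (\<Sum>i<n. t * b i * z ^ i)" using n by (auto simp: M_def)
    obtain c where c: "\<And>i. c i \<in> A" "1 = (\<Sum>i<m. t * c i * inverse z ^ i)" using m by (auto simp: M_def)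
    have "m \<noteq> 0" using c(2) by (intro notI) simp
    then obtain m' n' where mn: "m = Suc m'" "n = Suc n'" using m(2) by (cases m; cases n) auto
    define v where "v = inverse (1 + t * - c 0)"
    have vA: "v \<in> A" unfolding v_def by (rule unit[OF D(5)[OF c(1)]])
    have "1 + t * - c 0 = (\<Sum>i<m'. t * c (Suc i) * inverse z ^ Suc i)"
      using c(2) unfolding mn sum.lessThan_Suc_shift by (simp add: algebra_simps)
    moreover have "1 + t * - c 0 \<noteq> 0" using not1[OF c(1)[of 0]] by simp
    ultimately have "1 = v * (\<Sum>i<m'. t * c (Suc i) * inverse z ^ Suc i)" by (simp add: v_def)
    then have "z ^ n' = z ^ n' * (v * (\<Sum>i<m'. t * c (Suc i) * inverse z ^ Suc i))" by simp
    also have "\<dots> = (\<Sum>i<m'. t * (v * c (Suc i)) * (z ^ n' * inverse z ^ Suc i))"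
      by (simp add: sum_distrib_left mult_ac)
    also have "\<dots> = (\<Sum>i<m'. t * (v * c (Suc i)) * z ^ (n' - Suc i))"
      using m(2) mn z0 by (intro sum.cong refl arg_cong2[of _ _ _ _ "(*)"])
        (auto simp: power_diff power_inverse divide_inverse)
    finally have zn: "z ^ n' = (\<Sum>i<m'. t * (v * c (Suc i)) * z ^ (n' - Suc i))" .
    have "1 = (\<Sum>i<n'. t * b i * z ^ i) + t * b n' * z ^ n'" using b(2) mn(2) by simp
    also have "t * b n' * z ^ n' = (\<Sum>i<m'. t * (t * b n' * v * c (Suc i)) * z ^ (n' - Suc i))"
      by (subst zn) (simp add: sum_distrib_left mult_ac)
    also have "(\<Sum>i<n'. t * b i * z ^ i) + \<dots> \<in> M z n'"
    proof (rule M_add)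
      show "(\<Sum>i<n'. t * b i * z ^ i) \<in> M z n'" by (intro M_sum M_monom b) auto
      show "(\<Sum>i<m'. t * (t * b n' * v * c (Suc i)) * z ^ (n' - Suc i)) \<in> M z n'"
        using m(2) mn by (intro M_sum M_monom D A(2) b c vA) auto
    qed
    finally show ?thesis using mn(2) by blast
  qed
  have "x \<in> A \<or> inverse x \<in> A" for x
  proof (rule ccontr)
    assume x: "\<not> (x \<in> A \<or> inverse x \<in> A)"
    then have x0: "x \<noteq> 0" using D(1) by auto
    define n where "n = (LEAST n. 1 \<in> M x n)"
    define m where "m = (LEAST m. 1 \<in> M (inverse x) m)"
    have n: "1 \<in> M x n" unfolding n_def using ex[of x] x by (auto intro: LeastI_ex)
    have m: "1 \<in> M (inverse x) m" unfolding m_def using ex[of "inverse x"] x by (auto intro: LeastI_ex)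
    show False
    proof (cases "m \<le> n")
      case True
      then show False using reduce[OF x0 n m] not_less_Least unfolding n_def by blast
    next
      case False
      then show False using reduce[of "inverse x" m n] x0 n m not_less_Least unfolding m_def by force
    qed
  qed
  then show ?thesis using A by blast
qed

text \<open>The nonunits of a valuation ring form an ideal, so \<open>1 + ta\<close> is a unit when \<open>t\<close> is not.\<close>

lemma valuation_unit:
  fixes A :: "'k::field set"
  assumes A: "unital_subring A" "\<And>x. x \<in> A \<or> inverse x \<in> A" "t \<in> A" "inverse t \<notin> A" and a: "a \<in> A"
  shows "1 + t * a \<noteq> 0" "inverse (1 + t * a) \<in> A"
proof -
  note D = unital_subringD[OF A(1)]
  have not1: "t * b \<noteq> 1" if "b \<in> A" for b using that A(4) inverse_unique by blast
  define u where "u = 1 + t * a"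
  have u0: "u \<noteq> 0" using not1[OF D(5)[OF a]] by (auto simp: u_def add_eq_0_iff)
  then show "1 + t * a \<noteq> 0" by (simp add: u_def)
  have t0: "t \<noteq> 0" using A(4) D(1) by auto
  have "u * inverse t \<in> A \<or> inverse (u * inverse t) \<in> A" by (rule A(2))
  then show "inverse (1 + t * a) \<in> A"
  proof
    assume "u * inverse t \<in> A"
    moreover have "t * (u * inverse t - a) = 1" using t0 by (simp add: u_def algebra_simps)
    ultimately show ?thesis using not1 D(4) a by blast
  next
    assume *: "inverse (u * inverse t) \<in> A"
    have "inverse u = 1 - a * inverse (u * inverse t)"
      using u0 t0 by (simp add: field_simps) (simp add: u_def algebra_simps)
    then show ?thesis using D(4)[OF D(2) D(6)[OF a *]] by (simp add: u_def)
  qed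
qed

lemma common_denominator:
  fixes A :: "'k::field set"
  assumes A: "unital_subring A" "\<And>x. x \<in> A \<or> inverse x \<in> A" and "finite C"
  shows "\<exists>r\<in>A. r \<noteq> 0 \<and> (\<forall>c\<in>C. r * c \<in> A)"
  using assms(3)
proof (induction C)
  case empty
  then show ?case using unital_subringD(2)[OF A(1)] by (intro bexI[of _ 1]) auto
next
  case (insert c C)
  note D = unital_subringD[OF A(1)]
  obtain r where r: "r \<in> A" "r \<noteq> 0" "\<And>c. c \<in> C \<Longrightarrow> r * c \<in> A" using insert by auto
  obtain s where s: "s \<in> A" "s \<noteq> 0" "s * c \<in> A"
  proof (cases "c \<in> A")
    case True
    then show thesis using that[of 1] D by simp
  next
    case False
    then have "c \<noteq> 0" "inverse c \<in> A" using D(1) A(2) by auto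
    then show thesis using that[of "inverse c"] D(2) by simp
  qed
  have "s * r * d \<in> A" if "d \<in> insert c C" for d
  proof (cases "d = c")
    case True
    have "s * r * d = r * (s * c)" using True by (simp add: mult_ac)
    then show ?thesis using D(6)[OF r(1) s(3)] by metis
  next
    case False
    then have "s * (r * d) \<in> A" using that r(3) s(1) D(6) by simp
    then show ?thesis by (simp add: mult.assoc)
  qed
  then show ?case using r s D(6) by (intro bexI[of _ "s * r"]) auto
qed

text \<open>Divisibility is a total preorder, so a finite family has a member that divides all others.\<close>

lemma dominant_element:
  fixes A :: "'k::field set"
  assumes A: "unital_subring A" "\<And>x. x \<in> A \<or> inverse x \<in> A"
    and "finite I" "\<exists>i\<in>I. f i \<noteq> 0"
  shows "\<exists>i\<in>I. f i \<noteq> 0 \<and> (\<forall>j\<in>I. inverse (f i) * f j \<in> A)"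
  using assms(3,4)
proof (induction I)
  case (insert k I)
  note D = unital_subringD[OF A(1)]
  show ?case
  proof (cases "\<exists>i\<in>I. f i \<noteq> 0")
    case False
    then have "f k \<noteq> 0" "\<And>i. i \<in> I \<Longrightarrow> f i = 0" using insert.prems by auto
    then show ?thesis using D(1,2) by (intro bexI[of _ k]) auto
  next
    case True
    then obtain i where i: "i \<in> I" "f i \<noteq> 0" "\<And>j. j \<in> I \<Longrightarrow> inverse (f i) * f j \<in> A"
      using insert.IH by blast
    show ?thesis
    proof (cases "inverse (f i) * f k \<in> A")
      case True
      then show ?thesis using i by (intro bexI[of _ i]) auto
    next
      case False
      then have k: "f k \<noteq> 0" "inverse (f k) * f i \<in> A"
        using A(2)[of "inverse (f i) * f k"] D(1) by (auto simp: mult.commute)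
      have "inverse (f k) * f j \<in> A" if "j \<in> I" for j
      proof -
        have "inverse (f k) * f j = (inverse (f k) * f i) * (inverse (f i) * f j)"
          using i(2) by simp
        then show ?thesis using D(6)[OF k(2) i(3)[OF that]] by metis
      qed
      then show ?thesis using k D(2) by (intro bexI[of _ k]) auto
    qed
  qed
qed simp

section \<open>Coordinates over the center\<close>

lemma of_center_ops:
  "of_center (x * y) = of_center x * of_center y" "of_center (x + y) = of_center x + of_center y"
  "of_center 0 = 0" "of_center 1 = 1" "of_center (- x) = - of_center x"
  "of_center (x - y) = of_center x - of_center y" "of_center (inverse x) = inverse (of_center x)"
  by (simp_all add: times_center.rep_eq plus_center.rep_eq zero_center.rep_eq one_center.rep_eq
      uminus_center.rep_eq minus_center.rep_eq inverse_center.rep_eq)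

lemma of_center_of_nat: "of_center (of_nat n) = of_nat n"
  by (induction n) (simp_all add: of_center_ops)

lemma of_center_power: "of_center (x ^ n) = of_center x ^ n"
  by (induction n) (simp_all add: of_center_ops)

notation center_scale (infixr \<open>\<cdot>\<close> 75)

interpretation center_space: vector_space "center_scale :: 'a::division_ring center \<Rightarrow> 'a \<Rightarrow> 'a"
  by (rule vector_space_center_scale)

lemma scale_mult_left: "(c \<cdot> x) * y = c \<cdot> (x * y)"
  by (simp add: center_scale_def mult.assoc)

lemma scale_mult_right: "x * (c \<cdot> y) = c \<cdot> (x * y)"
  using ring_centerD[OF of_center, of c x]
  by (simp add: center_scale_def mult.assoc[symmetric])

lemma scale_in:
  assumes "division_subring D" "ring_center \<subseteq> D" "x \<in> D"
  shows "c \<cdot> x \<in> D"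
  unfolding center_scale_def using assms of_center[of c] by (intro division_subringD(6)) auto

lemma ring_center_subset_relative_center:
  "ring_center \<subseteq> D \<Longrightarrow> ring_center \<subseteq> relative_center D"
  by (auto simp: relative_center_def ring_center_def)

lemma subspace_division_subring:
  assumes "division_subring D" "ring_center \<subseteq> D"
  shows "center_space.subspace D"
  using division_subringD[OF assms(1)] scale_in[OF assms] by (intro center_space.subspaceI) auto

text \<open>Coordinates of a division subring \<open>D\<close> that is finite dimensional over the center, in a basis
  indexed by \<open>I\<close> that extends a basis, indexed by \<open>J\<close>, of the center of \<open>D\<close>; and a valuation ring
  \<open>A\<close>, with \<open>t\<close> in its maximal ideal, for which the elements with coordinates in \<open>A\<close> form a
  multiplicatively closed lattice.  The lattice need not contain \<open>1\<close>, so the basis can simply be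
  scaled until its structure constants are in \<open>A\<close>.\<close>

locale center_lattice =
  fixes D :: "'a::division_ring set" and I J :: "'b set" and \<psi> :: "'b \<Rightarrow> 'a \<Rightarrow> 'a center"
    and A :: "'a center set" and t :: "'a center"
  assumes ring: "division_subring D" and center: "ring_center \<subseteq> D"
    and finite_I: "finite I"
    and coord_add: "x \<in> D \<Longrightarrow> y \<in> D \<Longrightarrow> \<psi> i (x + y) = \<psi> i x + \<psi> i y"
    and coord_scale: "x \<in> D \<Longrightarrow> \<psi> i (c \<cdot> x) = c * \<psi> i x"
    and coord_zero: "x \<in> D \<Longrightarrow> (\<And>i. i \<in> I \<Longrightarrow> \<psi> i x = 0) \<Longrightarrow> x = 0"
    and coord_center: "x \<in> D \<Longrightarrow> x \<in> relative_center D \<longleftrightarrow> (\<forall>i\<in>I - J. \<psi> i x = 0)"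
    and coord_project: "x \<in> D \<Longrightarrow> \<exists>f\<in>relative_center D. \<forall>i\<in>J. \<psi> i f = \<psi> i x"
    and coord_mult: "x \<in> D \<Longrightarrow> y \<in> D \<Longrightarrow> (\<And>i. i \<in> I \<Longrightarrow> \<psi> i x \<in> A) \<Longrightarrow> (\<And>i. i \<in> I \<Longrightarrow> \<psi> i y \<in> A)
      \<Longrightarrow> i \<in> I \<Longrightarrow> \<psi> i (x * y) \<in> A"
    and A_ring: "unital_subring A" and A_valuation: "c \<in> A \<or> inverse c \<in> A"
    and t: "t \<in> A" "inverse t \<notin> A"

lemma center_lattice_exists:
  fixes D :: "'a::division_ring set"
  assumes D: "division_subring D" "ring_center \<subseteq> D" "finite_dimensional_over_center D"
    and A: "unital_subring A" "\<And>x. x \<in> A \<or> inverse x \<in> A" "t \<in> A" "inverse t \<notin> A"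
  shows "\<exists>I J (\<psi> :: 'a \<Rightarrow> 'a \<Rightarrow> 'a center). center_lattice D I J \<psi> A t"
proof -
  obtain B0 where B0: "finite B0" "D = center_space.span B0"
    using D(3) unfolding finite_dimensional_over_center_def by blast
  have sub: "center_space.subspace D" by (rule subspace_division_subring[OF D(1,2)])
  have subc: "center_space.subspace (relative_center D)"
    by (intro subspace_division_subring division_subring_relative_center
        ring_center_subset_relative_center D)
  have cD: "relative_center D \<subseteq> D" by (auto simp: relative_center_def)
  obtain J where J: "J \<subseteq> relative_center D" "center_space.independent J" "relative_center D \<subseteq> center_space.span J"
    by (rule center_space.maximal_independent_subset)
  have spanJ: "center_space.span J = relative_center D"
    using J(1,3) center_space.span_minimal[OF J(1) subc] by blast
  obtain I where I: "J \<subseteq> I" "I \<subseteq> D" "center_space.independent I" "D \<subseteq> center_space.span I"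
    using center_space.maximal_independent_subset_extend[of J D] J cD by blast
  have spanI: "center_space.span I = D" using I(4) center_space.span_minimal[OF I(2) sub] by blast
  have finI: "finite I" using center_space.independent_span_bound[OF B0(1) I(3)] I(2) B0(2) by blast
  have finJ: "finite J" using finite_subset[OF I(1) finI] .
  define \<phi> where "\<phi> b x = center_space.representation I x b" for b x
  define C where "C = (\<lambda>(b, c, d). \<phi> d (b * c)) ` (I \<times> I \<times> I)"
  have "finite C" unfolding C_def using finI by simp
  from common_denominator[OF A(1,2) this] obtain r where r: "r \<in> A" "r \<noteq> 0" "\<And>c. c \<in> C \<Longrightarrow> r * c \<in> A"
    by blast
  define \<psi> where "\<psi> b x = \<phi> b x / r" for b x
  note AD = unital_subringD[OF A(1)]
  have phi_add: "\<phi> b (x + y) = \<phi> b x + \<phi> b y" if "x \<in> D" "y \<in> D" for b x y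
    using center_space.representation_add[OF I(3), of y x] that spanI by (simp add: \<phi>_def)
  have phi_scale: "\<phi> b (c \<cdot> x) = c * \<phi> b x" if "x \<in> D" for b x c
    using center_space.representation_scale[OF I(3), of x c] that spanI by (simp add: \<phi>_def)
  have phi_sum: "\<phi> b (\<Sum>k\<in>K. f k) = (\<Sum>k\<in>K. \<phi> b (f k))" if "\<And>k. k \<in> K \<Longrightarrow> f k \<in> D" for b f and K :: "'a set"
    unfolding \<phi>_def using center_space.representation_sum[OF I(3), of K f] that spanI by simp
  have repr: "(\<Sum>b\<in>I. \<phi> b x \<cdot> b) = x" if "x \<in> D" for x
    unfolding \<phi>_def using that spanI finI by (intro center_space.sum_representation_eq I(3)) auto
  have basis: "\<phi> b c = (if b = c then 1 else 0)" if "c \<in> I" for b c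
    using center_space.representation_basis[OF I(3) that] by (simp add: \<phi>_def)
  have psi_0_iff: "\<psi> b x = 0 \<longleftrightarrow> \<phi> b x = 0" for b x using r(2) by (simp add: \<psi>_def)
  have "center_lattice D I J \<psi> A t"
  proof
    show "\<psi> i (x + y) = \<psi> i x + \<psi> i y" if "x \<in> D" "y \<in> D" for x y i
      using phi_add[OF that] by (simp add: \<psi>_def add_divide_distrib)
    show "\<psi> i (c \<cdot> x) = c * \<psi> i x" if "x \<in> D" for x i c
      using phi_scale[OF that] by (simp add: \<psi>_def)
    show "x = 0" if "x \<in> D" "\<And>i. i \<in> I \<Longrightarrow> \<psi> i x = 0" for x
      using repr[OF that(1)] that(2) psi_0_iff by simp
    show "x \<in> relative_center D \<longleftrightarrow> (\<forall>i\<in>I - J. \<psi> i x = 0)" if x: "x \<in> D" for x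
    proof
      assume "x \<in> relative_center D"
      then have "center_space.representation I x = center_space.representation J x"
        using spanJ by (intro center_space.representation_extend I(3,1)) auto
      then show "\<forall>i\<in>I - J. \<psi> i x = 0"
        using center_space.representation_ne_zero[of J x] by (auto simp: psi_0_iff \<phi>_def)
    next
      assume "\<forall>i\<in>I - J. \<psi> i x = 0"
      then have "(\<Sum>b\<in>I. \<phi> b x \<cdot> b) = (\<Sum>b\<in>J. \<phi> b x \<cdot> b)"
        using I(1) finI by (intro sum.mono_neutral_right) (auto simp: psi_0_iff)
      moreover have "(\<Sum>b\<in>J. \<phi> b x \<cdot> b) \<in> center_space.span J"
        by (intro center_space.span_sum center_space.span_scale center_space.span_base)
      ultimately show "x \<in> relative_center D" using repr[OF x] spanJ by simp
    qed
    show "\<exists>f\<in>relative_center D. \<forall>i\<in>J. \<psi> i f = \<psi> i x" if x: "x \<in> D" for x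
    proof
      define f where "f = (\<Sum>b\<in>J. \<phi> b x \<cdot> b)"
      show "f \<in> relative_center D"
        unfolding f_def spanJ[symmetric]
        by (intro center_space.span_sum center_space.span_scale center_space.span_base)
      have "\<phi> i f = \<phi> i x" if "i \<in> J" for i
      proof -
        have JD: "b \<in> D" "b \<in> I" if "b \<in> J" for b using that I by auto
        have "\<phi> i f = (\<Sum>b\<in>J. \<phi> b x * \<phi> i b)"
          unfolding f_def using JD by (subst phi_sum) (auto simp: phi_scale intro: scale_in[OF D(1,2)])
        also have "\<dots> = (\<Sum>b\<in>J. if b = i then \<phi> i x else 0)"
          using JD by (intro sum.cong) (auto simp: basis)
        finally show ?thesis using that finJ by simp
      qed
      then show "\<forall>i\<in>J. \<psi> i f = \<psi> i x" by (simp add: \<psi>_def)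
    qed
    show "\<psi> i (x * y) \<in> A"
      if xy: "x \<in> D" "y \<in> D" and xA: "\<And>i. i \<in> I \<Longrightarrow> \<psi> i x \<in> A" and yA: "\<And>i. i \<in> I \<Longrightarrow> \<psi> i y \<in> A"
        and i: "i \<in> I" for x y i
    proof -
      have ID: "b * c \<in> D" if "b \<in> I" "c \<in> I" for b c using that I(2) division_subringD(6)[OF D(1)] by blast
      have "x * y = (\<Sum>b\<in>I. \<phi> b x \<cdot> b) * (\<Sum>c\<in>I. \<phi> c y \<cdot> c)" using repr xy by simp
      also have "\<dots> = (\<Sum>b\<in>I. \<Sum>c\<in>I. (\<phi> b x * \<phi> c y) \<cdot> (b * c))"
        by (simp add: sum_product scale_mult_left scale_mult_right mult.commute)
      finally have "\<phi> i (x * y) = (\<Sum>b\<in>I. \<Sum>c\<in>I. \<phi> b x * \<phi> c y * \<phi> i (b * c))"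
        using ID by (simp add: phi_sum phi_scale scale_in[OF D(1,2)] division_subring_sum[OF D(1)])
      then have "\<psi> i (x * y) = (\<Sum>b\<in>I. \<Sum>c\<in>I. \<psi> b x * \<psi> c y * (r * \<phi> i (b * c)))"
        using r(2) by (simp add: \<psi>_def sum_divide_distrib field_simps power2_eq_square)
      also have "\<dots> \<in> A"
      proof (intro unital_subring_sum[OF A(1)])
        fix b c assume bc: "b \<in> I" "c \<in> I"
        have "\<phi> i (b * c) \<in> C" unfolding C_def using bc i by force
        then show "\<psi> b x * \<psi> c y * (r * \<phi> i (b * c)) \<in> A" by (intro AD(6) r(3) xA yA bc)
      qed
      finally show ?thesis .
    qed
  qed (use D A finI in auto)
  then show ?thesis by blast
qed

section \<open>Elements close to 1\<close>

text \<open>The commutators of \<open>a\<close> with \<open>1 + c\<close> and with \<open>1 + s c\<close> cannot both be central: if they are \<open>z\<close> and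
  \<open>w\<close>, then \<open>(1 + c) a = z a (1 + c)\<close> and \<open>(1 + s c) a = w a (1 + s c)\<close>, and eliminating \<open>c a\<close> expresses
  \<open>c\<close> by central elements.\<close>

lemma commutators_both_central:
  fixes a c :: "'a::division_ring"
  assumes D: "division_subring D" "a \<in> D" "c \<in> D" and s: "s \<in> relative_center D" "s \<noteq> 0" "s \<noteq> 1"
    and ca: "c * a \<noteq> a * c"
    and z: "(1 + c) * a * inverse (1 + c) * inverse a \<in> relative_center D"
    and w: "(1 + s * c) * a * inverse (1 + s * c) * inverse a \<in> relative_center D"
  shows False
proof -
  define z1 w1 where "z1 = (1 + c) * a * inverse (1 + c) * inverse a"
    and "w1 = (1 + s * c) * a * inverse (1 + s * c) * inverse a"
  note Z = relative_centerD[of _ D] and ZD = division_subringD[OF division_subring_relative_center[OF D(1)]]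
  have a0: "a \<noteq> 0" using ca by auto
  have sa: "s * a = a * s" and sc: "s * c = c * s" using Z[OF s(1)] D by auto
  have "c = - 1" if "1 + c = 0" using that by (simp add: eq_neg_iff_add_eq_0 add.commute)
  then have 1: "1 + c \<noteq> 0" using ca by auto
  have "(s * c) * a \<noteq> a * (s * c)"
  proof
    assume "(s * c) * a = a * (s * c)"
    then have "s * (c * a) = s * (a * c)" by (metis mult.assoc sa)
    then show False using s(2) ca by simp
  qed
  moreover have "s * c = - 1" if "1 + s * c = 0" using that by (simp add: eq_neg_iff_add_eq_0 add.commute)
  ultimately have 2: "1 + s * c \<noteq> 0" by auto
  have "z1 * a * (1 + c) = (1 + c) * a" using 1 a0 by (simp add: z1_def mult.assoc)
  moreover have "z1 * a = a * z1" using Z z D(2) by (simp add: z1_def)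
  ultimately have e1: "(1 + c) * a = a * z1 * (1 + c)" by simp
  have "w1 * a * (1 + s * c) = (1 + s * c) * a" using 2 a0 by (simp add: w1_def mult.assoc)
  moreover have "w1 * a = a * w1" using Z w D(2) by (simp add: w1_def)
  ultimately have e2: "(1 + s * c) * a = a * w1 * (1 + s * c)" by simp
  have zw: "z1 \<in> relative_center D" "w1 \<in> relative_center D" using z w by (auto simp: z1_def w1_def)
  have sw: "s * w1 = w1 * s" "s * z1 = z1 * s" using Z[OF s(1)] zw by (auto simp: relative_center_def)
  have "a * (s - 1) = s * ((1 + c) * a) - (1 + s * c) * a"
    by (simp add: algebra_simps sa[symmetric])
  also have "\<dots> = s * (a * z1 * (1 + c)) - a * w1 * (1 + s * c)" unfolding e1 e2 ..
  also have "\<dots> = a * (s * z1 - w1 + s * (z1 - w1) * c)"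
  proof -
    have "s * (a * z1 * (1 + c)) = a * (s * z1 * (1 + c))"
      by (simp add: mult.assoc[symmetric] sa)
    moreover have "w1 * (s * c) = s * w1 * c" by (simp add: sw(1) mult.assoc)
    ultimately show ?thesis by (simp add: algebra_simps)
  qed
  finally have eq: "s - 1 = s * z1 - w1 + s * (z1 - w1) * c" using a0 by simp
  show False
  proof (cases "z1 = w1")
    case True
    then have "(s - 1) * 1 = (s - 1) * z1" using eq by (simp add: algebra_simps)
    then have "z1 = 1" using s(3) by simp
    then show False using e1 ca by (simp add: algebra_simps)
  next
    case False
    then have "c = inverse (s * (z1 - w1)) * (s - 1 - (s * z1 - w1))"
    proof -
      define X where "X = s * (z1 - w1)"
      have "X \<noteq> 0" using False s(2) by (simp add: X_def)
      then have "c = inverse X * (X * c)" by (simp flip: mult.assoc)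
      also have "X * c = s - 1 - (s * z1 - w1)" using eq by (simp add: X_def)
      finally show ?thesis by (simp add: X_def)
    qed
    moreover have "\<dots> \<in> relative_center D" by (intro ZD s zw)
    ultimately have "c \<in> relative_center D" by simp
    then show False using Z[of c a] D(2) ca by simp
  qed
qed

context center_lattice
begin

definition lattice :: "'a set" where
  "lattice = {x \<in> D. \<forall>i\<in>I. \<psi> i x \<in> A}"

definition infinitesimal :: "'a set" where
  "infinitesimal = (\<lambda>x. t \<cdot> x) ` lattice"

lemmas D_closed = division_subringD[OF ring]
lemmas A_closed = unital_subringD[OF A_ring]
lemmas D_scale = scale_in[OF ring center]

abbreviation Z :: "'a set" where "Z \<equiv> relative_center D"

lemmas Z_closed = division_subringD[OF division_subring_relative_center[OF ring]]

lemma Z_D: "z \<in> Z \<Longrightarrow> z \<in> D"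
  by (simp add: relative_center_def)

lemma Z_scale: "z \<in> Z \<Longrightarrow> c \<cdot> z \<in> Z"
  by (rule scale_in[OF division_subring_relative_center[OF ring] ring_center_subset_relative_center[OF center]])

lemma t_nonzero: "t \<noteq> 0" and t_not_1: "t \<noteq> 1"
  using t A_closed(1,2) by auto

lemma coord_diff: "x \<in> D \<Longrightarrow> y \<in> D \<Longrightarrow> \<psi> i (x - y) = \<psi> i x - \<psi> i y"
  using coord_add[of x "- 1 \<cdot> y" i] coord_scale[of y i "- 1"] D_scale[of y "- 1"]
  by (simp add: center_scale_def of_center_ops)

lemma lattice_D: "x \<in> lattice \<Longrightarrow> x \<in> D"
  by (simp add: lattice_def)

lemma lattice_add: "x \<in> lattice \<Longrightarrow> y \<in> lattice \<Longrightarrow> x + y \<in> lattice"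
  by (auto simp: lattice_def coord_add D_closed A_closed)

lemma lattice_diff: "x \<in> lattice \<Longrightarrow> y \<in> lattice \<Longrightarrow> x - y \<in> lattice"
  by (auto simp: lattice_def coord_diff D_closed A_closed)

lemma lattice_mult: "x \<in> lattice \<Longrightarrow> y \<in> lattice \<Longrightarrow> x * y \<in> lattice"
  by (auto simp: lattice_def D_closed intro: coord_mult)

lemma lattice_scale: "c \<in> A \<Longrightarrow> x \<in> lattice \<Longrightarrow> c \<cdot> x \<in> lattice"
  by (auto simp: lattice_def D_scale coord_scale A_closed)

lemma lattice_0: "0 \<in> lattice"
  using coord_scale[of 0 _ 0] D_closed(1) A_closed(1) by (simp add: lattice_def)

lemma lattice_sum: "(\<And>k. k \<in> K \<Longrightarrow> f k \<in> lattice) \<Longrightarrow> sum f K \<in> lattice"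
  by (induction K rule: infinite_finite_induct) (auto simp: lattice_0 lattice_add)

lemma infinitesimalI: "x \<in> lattice \<Longrightarrow> t \<cdot> x \<in> infinitesimal"
  unfolding infinitesimal_def by (rule imageI)

lemma infinitesimalE:
  assumes "x \<in> infinitesimal"
  obtains y where "y \<in> lattice" "x = t \<cdot> y"
  using assms by (auto simp: infinitesimal_def)

lemma infinitesimal_lattice: "x \<in> infinitesimal \<Longrightarrow> x \<in> lattice"
  by (auto simp: infinitesimal_def lattice_scale t(1))

lemma infinitesimal_add: "x \<in> infinitesimal \<Longrightarrow> y \<in> infinitesimal \<Longrightarrow> x + y \<in> infinitesimal"
  by (elim infinitesimalE) (auto simp flip: center_space.scale_right_distrib intro: infinitesimalI lattice_add)

lemma infinitesimal_mult:
  "x \<in> infinitesimal \<Longrightarrow> y \<in> lattice \<Longrightarrow> x * y \<in> infinitesimal"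
  "x \<in> lattice \<Longrightarrow> y \<in> infinitesimal \<Longrightarrow> x * y \<in> infinitesimal"
  by (auto elim!: infinitesimalE simp: scale_mult_left scale_mult_right intro!: infinitesimalI intro: lattice_mult)

lemma scale_into_lattice:
  assumes "x \<in> D"
  shows "\<exists>r\<in>A. r \<noteq> 0 \<and> r \<cdot> x \<in> lattice"
proof -
  obtain r where "r \<in> A" "r \<noteq> 0" "\<And>c. c \<in> (\<lambda>i. \<psi> i x) ` I \<Longrightarrow> r * c \<in> A"
    using common_denominator[OF A_ring A_valuation, of "(\<lambda>i. \<psi> i x) ` I"] finite_I by auto
  then show ?thesis
    using assms by (intro bexI[of _ r]) (auto simp: lattice_def coord_scale D_scale)
qed

text \<open>The element \<open>y = 1 - (1 + g)\<^sup>-\<^sup>1\<close> satisfies \<open>y + g y = g\<close>.  Writing \<open>y = c u\<close> with \<open>u\<close> in the lattice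
  and one coordinate of \<open>u\<close> equal to 1, this coordinate of \<open>u + g u\<close> is a unit, so \<open>c\<close> must absorb
  the factor \<open>t\<close> of \<open>g\<close>.\<close>

lemma inverse_near_1:
  assumes g: "g \<in> infinitesimal" "1 + g \<noteq> 0"
  shows "1 - inverse (1 + g) \<in> infinitesimal"
proof -
  define y where "y = 1 - inverse (1 + g)"
  have gD: "g \<in> D" using g(1) infinitesimal_lattice lattice_D by blast
  have yD: "y \<in> D" unfolding y_def by (intro D_closed gD)
  have "(1 + g) * y = g" using g(2) by (simp add: y_def right_diff_distrib)
  then have y: "y + g * y = g" by (simp add: distrib_right)
  show ?thesis
  proof (cases "\<exists>i\<in>I. \<psi> i y \<noteq> 0")
    case False
    then have "y = 0" using coord_zero[OF yD] by blast
    then show ?thesis using infinitesimalI[OF lattice_0] by (simp add: y_def)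
  next
    case True
    obtain i where i: "i \<in> I" "\<psi> i y \<noteq> 0" "\<And>j. j \<in> I \<Longrightarrow> inverse (\<psi> i y) * \<psi> j y \<in> A"
      using dominant_element[OF A_ring A_valuation finite_I True] by blast
    define c where "c = \<psi> i y"
    define u where "u = inverse c \<cdot> y"
    have u: "u \<in> lattice" using i(3) yD by (auto simp: u_def lattice_def D_scale coord_scale c_def)
    have cu: "c \<cdot> u = y" using i(2) by (simp add: u_def c_def)
    have "g * u \<in> infinitesimal" using infinitesimal_mult(1)[OF g(1) u] .
    then obtain m where m: "m \<in> lattice" "g * u = t \<cdot> m" by (rule infinitesimalE)
    obtain n where n: "n \<in> lattice" "g = t \<cdot> n" using g(1) by (rule infinitesimalE)
    have mA: "\<psi> i m \<in> A" "\<psi> i n \<in> A" using m(1) n(1) i(1) by (auto simp: lattice_def)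
    have "\<psi> i (c \<cdot> (u + t \<cdot> m)) = \<psi> i (t \<cdot> n)"
      by (rule arg_cong[of _ _ "\<psi> i"])
        (simp add: center_space.scale_right_distrib cu flip: m(2) n(2) scale_mult_right, simp add: cu y)
    moreover have "\<psi> i u = 1" using i(2) yD by (simp add: u_def c_def coord_scale)
    ultimately have "c * (1 + t * \<psi> i m) = t * \<psi> i n"
      using lattice_D[OF u] lattice_D[OF m(1)] lattice_D[OF n(1)]
      by (simp add: coord_scale coord_add D_scale D_closed)
    then have "c = t * (\<psi> i n * inverse (1 + t * \<psi> i m))"
      using valuation_unit(1)[OF A_ring A_valuation t mA(1)] by (simp add: field_simps)
    moreover have "\<psi> i n * inverse (1 + t * \<psi> i m) \<in> A"
      by (intro A_closed valuation_unit(2)[OF A_ring A_valuation t] mA)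
    ultimately obtain d where d: "d \<in> A" "c = t * d" by blast
    have "y = t \<cdot> (d \<cdot> u)" using cu d(2) by simp
    then show ?thesis using infinitesimalI[OF lattice_scale[OF d(1) u]] by (simp add: y_def)
  qed
qed

text \<open>The difference of \<open>x a x\<^sup>-\<^sup>1 a\<^sup>-\<^sup>1\<close> and 1 is \<open>(x a - a x) x\<^sup>-\<^sup>1 a\<^sup>-\<^sup>1\<close>.  For \<open>x = 1 + c\<close> with \<open>c\<close> divisible
  enough, the factors \<open>t\<close> of \<open>c\<close> outweigh the denominators of \<open>a\<close> and \<open>a\<^sup>-\<^sup>1\<close>.  The same holds for \<open>t c\<close>,
  and one of the two commutators is noncentral.\<close>

lemma noncentral_commutator_near_1:
  assumes a: "a \<in> D" "a \<notin> Z"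
  shows "\<exists>x\<in>D. x \<noteq> 0 \<and> x * a * inverse x * inverse a \<notin> Z
    \<and> x * a * inverse x * inverse a - 1 \<in> infinitesimal"
proof -
  obtain b where b: "b \<in> D" "b * a \<noteq> a * b" using a by (force simp: relative_center_def)
  have a0: "a \<noteq> 0" using b by auto
  obtain r1 where r1: "r1 \<in> A" "r1 \<noteq> 0" "r1 \<cdot> a \<in> lattice" using scale_into_lattice[OF a(1)] by blast
  obtain r2 where r2: "r2 \<in> A" "r2 \<noteq> 0" "r2 \<cdot> inverse a \<in> lattice"
    using scale_into_lattice[OF D_closed(7)[OF a(1)]] by blast
  obtain r3 where r3: "r3 \<in> A" "r3 \<noteq> 0" "r3 \<cdot> b \<in> lattice" using scale_into_lattice[OF b(1)] by blast
  define a' a'' b' where "a' = r1 \<cdot> a" and "a'' = r2 \<cdot> inverse a" and "b' = r3 \<cdot> b"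
  define c where "c = (t * r1 * r2 * r3) \<cdot> b"
  have cD: "c \<in> D" unfolding c_def by (intro D_scale b)
  have near: "x * a * inverse x * inverse a - 1 \<in> infinitesimal" and nz: "x \<noteq> 0"
    if e: "e \<in> A" "e \<noteq> 0" and x: "x = 1 + e \<cdot> c" for e x
  proof -
    define g where "g = e \<cdot> c"
    have "g = t \<cdot> ((e * r1 * r2) \<cdot> b')" by (simp add: g_def c_def b'_def mult_ac)
    moreover have "(e * r1 * r2) \<cdot> b' \<in> lattice"
      unfolding b'_def by (intro lattice_scale A_closed e r1 r2 r3)
    ultimately have g: "g \<in> infinitesimal" using infinitesimalI by metis
    have comm: "g * a - a * g = (e * t * r1 * r2 * r3) \<cdot> (b * a - a * b)"
      by (simp add: g_def c_def scale_mult_left scale_mult_right center_space.scale_right_diff_distrib mult_ac)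
    then have "g * a \<noteq> a * g"
      using b(2) e(2) t_nonzero r1 r2 r3 by auto
    moreover have "g = - 1" if "1 + g = 0" using that by (simp add: eq_neg_iff_add_eq_0 add.commute)
    ultimately have g1: "1 + g \<noteq> 0" by auto
    then show "x \<noteq> 0" by (simp add: x g_def)
    define y where "y = 1 - inverse (1 + g)"
    have y: "y \<in> infinitesimal" unfolding y_def by (rule inverse_near_1[OF g g1])
    define w where "w = b' * a' - a' * b'"
    have w: "w \<in> lattice" unfolding w_def a'_def b'_def by (intro lattice_diff lattice_mult r1 r3)
    have "x * a * inverse x * inverse a - 1 = ((1 + g) * a - a * (1 + g)) * inverse (1 + g) * inverse a"
      using g1 a0 by (simp add: x flip: g_def) (simp add: left_diff_distrib mult.assoc)
    also have "\<dots> = (g * a - a * g) * (1 - y) * inverse a"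
      by (simp add: y_def algebra_simps)
    also have "\<dots> = t \<cdot> (e \<cdot> ((w - w * y) * a''))"
      unfolding comm w_def a'_def a''_def b'_def
      by (simp add: scale_mult_left scale_mult_right right_diff_distrib left_diff_distrib
          center_space.scale_right_diff_distrib mult_ac)
    also have "\<dots> \<in> infinitesimal"
      unfolding a''_def
      by (intro infinitesimalI lattice_scale lattice_mult lattice_diff e w r2 infinitesimal_lattice y)
    finally show "x * a * inverse x * inverse a - 1 \<in> infinitesimal" .
  qed
  have "of_center t * c = t \<cdot> c" by (simp add: center_scale_def)
  moreover have "c * a \<noteq> a * c"
    using b(2) t_nonzero r1 r2 r3 by (simp add: c_def scale_mult_left scale_mult_right)
  moreover have "of_center t \<in> Z"
    using of_center[of t] ring_center_subset_relative_center[OF center] by blast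
  moreover have "of_center t \<noteq> 0" "of_center t \<noteq> 1"
    using t_nonzero t_not_1 by (metis of_center_inject of_center_ops(3,4))+
  ultimately have "(1 + c) * a * inverse (1 + c) * inverse a \<notin> Z
      \<or> (1 + t \<cdot> c) * a * inverse (1 + t \<cdot> c) * inverse a \<notin> Z"
    using commutators_both_central[OF ring a(1) cD] by metis
  then show ?thesis
    using near[OF A_closed(2), of "1 + c"] nz[OF A_closed(2), of "1 + c"]
      near[OF t(1) t_nonzero refl] nz[OF t(1) t_nonzero refl] D_closed(2,3) cD D_scale[OF cD, of t]
    by (metis center_space.scale_one zero_neq_one)
qed

lemma near_1_mult:
  assumes "x - 1 \<in> infinitesimal" "y - 1 \<in> infinitesimal"
  shows "x * y - 1 \<in> infinitesimal"
proof -
  have "x * y - 1 = (x - 1) * (y - 1) + ((x - 1) + (y - 1))" by (simp add: algebra_simps)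
  also have "\<dots> \<in> infinitesimal"
    by (intro infinitesimal_add infinitesimal_mult infinitesimal_lattice assms)
  finally show ?thesis .
qed

lemma near_1_power: "x - 1 \<in> infinitesimal \<Longrightarrow> x ^ n - 1 \<in> infinitesimal"
  using infinitesimalI[OF lattice_0] by (induction n) (auto intro: near_1_mult)

lemma scale_power: "(c \<cdot> x) ^ n = c ^ n \<cdot> x ^ n"
  by (induction n) (simp_all add: scale_mult_left scale_mult_right mult_ac)

lemma of_nat_mult_scale: "of_nat n * (c \<cdot> x) = (of_nat n * c) \<cdot> x"
  by (simp add: center_scale_def of_center_ops of_center_of_nat mult.assoc)

text \<open>For \<open>s \<in> tA\<close> the terms of degree at least 2 in \<open>s\<close> of \<open>(f + s g)\<^sup>q\<close> are divisible by \<open>q s t\<close>, hence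
  negligible against the linear term.  This is the case if \<open>q\<close> is a unit of \<open>A\<close>, and for \<open>q = t = 3\<close>.
  With \<open>t = 3\<close> in characteristic 0 and with any \<open>t\<close> in positive characteristic, the only prime that
  is not tame is the characteristic.\<close>

definition tame :: "nat \<Rightarrow> bool" where
  "tame q \<longleftrightarrow> of_nat q \<noteq> (0 :: 'a center) \<and>
     (\<forall>k. 2 \<le> k \<longrightarrow> k \<le> q \<longrightarrow> (\<forall>a\<in>A. \<exists>e\<in>A. of_nat (q choose k) * (t * a) ^ (k - 1) = of_nat q * t * e))"

lemma tame_unit:
  assumes "inverse (of_nat q) \<in> A" "of_nat q \<noteq> (0 :: 'a center)"
  shows "tame q"
  unfolding tame_def
proof (intro conjI allI impI ballI)
  fix k a assume k: "2 \<le> k" "k \<le> q" and a: "a \<in> A"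
  obtain l where l: "k - 1 = Suc l" using k by (cases "k - 1") auto
  have "of_nat (q choose k) \<in> A" using A_closed(8)[of "int (q choose k)"] by simp
  then have "inverse (of_nat q) * of_nat (q choose k) * (a * (t * a) ^ l) \<in> A"
    using assms a t by (intro A_closed) auto
  moreover have "of_nat (q choose k) * (t * a) ^ (k - 1)
      = of_nat q * t * (inverse (of_nat q) * of_nat (q choose k) * (a * (t * a) ^ l))"
    unfolding l power_Suc using assms(2) by (simp add: mult_ac)
  ultimately show "\<exists>e\<in>A. of_nat (q choose k) * (t * a) ^ (k - 1) = of_nat q * t * e" by blast
qed (rule assms(2))

lemma tame_3:
  assumes "t = of_nat 3"
  shows "tame 3"
  unfolding tame_def
proof (intro conjI allI impI ballI)
  show "of_nat 3 \<noteq> (0 :: 'a center)" using t_nonzero assms by simp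
  fix k a assume k: "2 \<le> k" "k \<le> (3 :: nat)" and a: "a \<in> A"
  then consider "k = 2" | "k = 3" by linarith
  then show "\<exists>e\<in>A. of_nat (3 choose k) * (t * a) ^ (k - 1) = of_nat 3 * t * e"
  proof cases
    case 1
    then show ?thesis using a by (intro bexI[of _ a]) (auto simp: eval_nat_numeral)
  next
    case 2
    then have "of_nat (3 choose k) * (t * a) ^ (k - 1) = of_nat 3 * t * a ^ 2"
      using assms by (simp add: power2_eq_square mult_ac)
    then show ?thesis using A_closed(7)[OF a] by blast
  qed
qed

text \<open>Split \<open>v - 1\<close> into its central coordinates \<open>f\<^sub>0\<close> and the rest, and extract from the rest a
  coordinate \<open>s\<close> that divides all others.  This gives \<open>v = f + s g\<close> with \<open>f = 1 + f\<^sub>0\<close> central and a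
  noncentral coordinate of \<open>g\<close> equal to 1.  If \<open>v\<^sup>q\<close> were central, so would be
  \<open>(v\<^sup>q - f\<^sup>q) / (q s)\<close>, which is congruent to \<open>g\<close> modulo \<open>t\<close>.\<close>

lemma tame_power_not_central:
  assumes q: "prime q" "tame q" and v: "v \<in> D" "v \<notin> Z" "v - 1 \<in> infinitesimal"
  shows "v ^ q \<notin> Z"
proof
  assume vq: "v ^ q \<in> Z"
  define h where "h = v - 1"
  have hD: "h \<in> D" unfolding h_def by (intro D_closed v)
  have "h \<notin> Z" using v(2) Z_closed(3)[OF _ Z_closed(2), of h] by (auto simp: h_def)
  then have "\<exists>i\<in>I - J. \<psi> i h \<noteq> 0" using coord_center[OF hD] by blast
  from dominant_element[OF A_ring A_valuation finite_Diff[OF finite_I] this]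
  obtain i where i: "i \<in> I" "i \<notin> J" "\<psi> i h \<noteq> 0"
      and dom: "\<And>j. j \<in> I - J \<Longrightarrow> inverse (\<psi> i h) * \<psi> j h \<in> A" by auto
  define s where "s = \<psi> i h"
  have s0: "s \<noteq> 0" using i by (simp add: s_def)
  obtain m where m: "m \<in> lattice" "h = t \<cdot> m" using v(3) unfolding h_def by (rule infinitesimalE)
  have mD: "m \<in> D" using m(1) by (rule lattice_D)
  define s' where "s' = \<psi> i m"
  have s': "s' \<in> A" "s = t * s'" using m i(1) mD by (auto simp: s'_def s_def lattice_def coord_scale)
  obtain f0 where f0: "f0 \<in> Z" "\<And>j. j \<in> J \<Longrightarrow> \<psi> j f0 = \<psi> j h" using coord_project[OF hD] by blast
  have f0D: "f0 \<in> D" using f0(1) by (rule Z_D)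
  have f0_0: "\<psi> j f0 = 0" if "j \<in> I" "j \<notin> J" for j using coord_center[OF f0D] f0(1) that by blast
  have "inverse t * \<psi> j f0 \<in> A" if "j \<in> I" for j
  proof (cases "j \<in> J")
    case True
    have "inverse t * \<psi> j f0 = \<psi> j m" using True mD t_nonzero by (simp add: f0(2) m(2) coord_scale)
    then show ?thesis using m(1) that by (simp add: lattice_def)
  qed (use that f0_0 A_closed in simp)
  then have "inverse t \<cdot> f0 \<in> lattice" using f0D by (auto simp: lattice_def D_scale coord_scale)
  then have f0_inf: "f0 \<in> infinitesimal" using infinitesimalI[of "inverse t \<cdot> f0"] t_nonzero by simp
  define f where "f = 1 + f0"
  have fZ: "f \<in> Z" unfolding f_def by (intro Z_closed f0)
  define g where "g = inverse s \<cdot> (h - f0)"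
  have gD: "g \<in> D" unfolding g_def by (intro D_scale D_closed hD f0D)
  have g_coord: "\<psi> j g = (if j \<in> J then 0 else inverse s * \<psi> j h)" if "j \<in> I" for j
    using hD f0D f0(2) f0_0[OF that] by (simp add: g_def coord_scale coord_diff D_closed)
  have g: "g \<in> lattice" using gD g_coord dom A_closed(1) by (simp add: lattice_def s_def)
  have gi: "\<psi> i g = 1" using g_coord[OF i(1)] i(2) s0 by (simp add: s_def)
  have v_eq: "v = s \<cdot> g + f" using s0 by (simp add: g_def f_def h_def)
  have comm: "(s \<cdot> g) * f = f * (s \<cdot> g)"
    using relative_centerD[OF fZ D_scale[OF gD]] by simp
  have f_power: "f ^ n - 1 \<in> infinitesimal" for n
    using near_1_power[of f] f0_inf by (simp add: f_def)
  have gf: "g ^ k * f ^ n \<in> lattice" if "k > 0" for k n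
  proof -
    have "g ^ k \<in> lattice" using that
    proof (induction k rule: nat_induct_non_zero)
      case (Suc k)
      then show ?case using lattice_mult[OF g] by simp
    qed (simp add: g)
    moreover have "g ^ k * f ^ n = g ^ k * (f ^ n - 1) + g ^ k" by (simp add: algebra_simps)
    ultimately show ?thesis
      using lattice_add infinitesimal_lattice infinitesimal_mult(2) f_power by metis
  qed
  have "\<forall>k\<in>{2..q}. \<exists>e. e \<in> A \<and> of_nat (q choose k) * (t * s') ^ (k - 1) = of_nat q * t * e"
  proof
    fix k assume "k \<in> {2..q}"
    then show "\<exists>e. e \<in> A \<and> of_nat (q choose k) * (t * s') ^ (k - 1) = of_nat q * t * e"
      using q(2) s'(1) unfolding tame_def Bex_def atLeastAtMost_iff by blast
  qed
  from bchoice[OF this]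
  obtain e where "\<forall>k\<in>{2..q}. e k \<in> A \<and> of_nat (q choose k) * (t * s') ^ (k - 1) = of_nat q * t * e k"
    by (elim exE)
  then have e: "e k \<in> A" "of_nat (q choose k) * (t * s') ^ (k - 1) = of_nat q * t * e k"
    if "2 \<le> k" "k \<le> q" for k using that by auto
  have q0: "of_nat q \<noteq> (0 :: 'a center)" using q(2) by (simp add: tame_def)
  have q2: "2 \<le> q" using prime_ge_2_nat[OF q(1)] .
  have higher: "of_nat (q choose k) * (s \<cdot> g) ^ k * f ^ (q - k) = (of_nat q * s) \<cdot> (t \<cdot> (e k \<cdot> (g ^ k * f ^ (q - k))))"
    if k: "2 \<le> k" "k \<le> q" for k
  proof -
    have "of_nat (q choose k) * (s \<cdot> g) ^ k * f ^ (q - k) = (of_nat (q choose k) * s ^ k) \<cdot> (g ^ k * f ^ (q - k))"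
      by (simp add: scale_power of_nat_mult_scale scale_mult_left)
    also have "of_nat (q choose k) * s ^ k = of_nat q * s * (t * e k)"
    proof -
      have "s ^ k = s * (t * s') ^ (k - 1)" using k s'(2) by (metis Suc_diff_1 less_le_trans pos2 power_Suc)
      then show ?thesis using e(2)[OF k] by (simp add: mult_ac)
    qed
    finally show ?thesis by simp
  qed
  define r where "r = (\<Sum>k\<in>{2..q}. e k \<cdot> (g ^ k * f ^ (q - k)))"
  have r: "r \<in> lattice" unfolding r_def using e by (intro lattice_sum lattice_scale gf) auto
  have "v ^ q = (\<Sum>k\<le>q. of_nat (q choose k) * (s \<cdot> g) ^ k * f ^ (q - k))"
    unfolding v_eq by (rule binomial_commute[OF comm])
  also have "{..q} = insert 0 (insert 1 {2..q})" using q2 by auto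
  also have "(\<Sum>k\<in>insert 0 (insert 1 {2..q}). of_nat (q choose k) * (s \<cdot> g) ^ k * f ^ (q - k))
      = f ^ q + (of_nat q * (s \<cdot> g) * f ^ (q - 1)
        + (\<Sum>k\<in>{2..q}. of_nat (q choose k) * (s \<cdot> g) ^ k * f ^ (q - k)))" by simp
  also have "of_nat q * (s \<cdot> g) * f ^ (q - 1) = (of_nat q * s) \<cdot> (g * f ^ (q - 1))"
    by (simp add: of_nat_mult_scale scale_mult_left)
  also have "(\<Sum>k\<in>{2..q}. of_nat (q choose k) * (s \<cdot> g) ^ k * f ^ (q - k)) = (of_nat q * s) \<cdot> (t \<cdot> r)"
    unfolding r_def center_space.scale_sum_right by (intro sum.cong refl higher) auto
  finally have "v ^ q - f ^ q = (of_nat q * s) \<cdot> (g * f ^ (q - 1) + t \<cdot> r)"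
    by (simp add: center_space.scale_right_distrib)
  then have "g * f ^ (q - 1) + t \<cdot> r = inverse (of_nat q * s) \<cdot> (v ^ q - f ^ q)"
  proof -
    have "inverse (of_nat q * s) * (of_nat q * s) = 1" using q0 s0 by (intro left_inverse) simp
    then show ?thesis
      unfolding \<open>v ^ q - f ^ q = _\<close> center_space.scale_scale by simp
  qed
  also have "\<dots> \<in> Z" by (intro Z_scale Z_closed vq fZ)
  finally have "g * f ^ (q - 1) + t \<cdot> r \<in> Z" .
  moreover have "g * (f ^ (q - 1) - 1) \<in> infinitesimal" by (rule infinitesimal_mult(2)[OF g f_power])
  then obtain n where n: "n \<in> lattice" "g * (f ^ (q - 1) - 1) = t \<cdot> n" by (rule infinitesimalE)
  have "g * f ^ (q - 1) + t \<cdot> r = g + t \<cdot> (n + r)"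
    using n(2) by (simp add: algebra_simps center_space.scale_right_distrib)
  ultimately have "g + t \<cdot> (n + r) \<in> Z" by simp
  moreover have nr: "n + r \<in> lattice" by (rule lattice_add[OF n(1) r])
  have nrD: "t \<cdot> (n + r) \<in> D" by (rule D_scale[OF lattice_D[OF nr]])
  ultimately have "\<psi> i (g + t \<cdot> (n + r)) = 0"
    using coord_center[OF D_closed(3)[OF gD nrD]] i by blast
  then have "1 + t * \<psi> i (n + r) = 0"
    using gi coord_add[OF gD nrD] coord_scale[OF lattice_D[OF nr]] by simp
  moreover have "\<psi> i (n + r) \<in> A" using nr i(1) by (simp add: lattice_def)
  ultimately show False using valuation_unit(1)[OF A_ring A_valuation t] by blast
qed

lemma radical_near_1_wild:
  assumes v: "v \<in> D" "v \<notin> Z" "v - 1 \<in> infinitesimal" and m: "m > 0" "v ^ m \<in> Z"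
  shows "\<exists>q k. prime q \<and> \<not> tame q \<and> v ^ k \<notin> Z \<and> (v ^ k) ^ q \<in> Z"
proof -
  define n where "n = (LEAST m. m > 0 \<and> v ^ m \<in> Z)"
  have n: "n > 0 \<and> v ^ n \<in> Z"
    unfolding n_def by (rule LeastI[of "\<lambda>m. m > 0 \<and> v ^ m \<in> Z" m]) (use m in auto)
  have least: "v ^ k \<notin> Z" if "0 < k" "k < n" for k
    using not_less_Least[of k "\<lambda>m. m > 0 \<and> v ^ m \<in> Z"] that by (auto simp: n_def)
  have "n \<noteq> 1" using n v(2) by auto
  then obtain q where q: "prime q" "q dvd n" by (metis prime_factor_nat)
  then obtain k where k: "n = k * q" by (metis dvd_div_mult_self)
  have "0 < k" "k < n" using n k prime_gt_1_nat[OF q(1)] by auto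
  then have vk: "v ^ k \<notin> Z" by (rule least)
  have vkq: "(v ^ k) ^ q \<in> Z" using n k by (simp add: power_mult)
  then have "\<not> tame q"
    using tame_power_not_central[OF q(1) _ D_closed(8)[OF v(1)] vk near_1_power[OF v(3)]] by blast
  then show ?thesis using q(1) vk vkq by blast
qed

end

section \<open>Inseparable elements\<close>

text \<open>The binomial formula for the difference of the left and right multiplications by \<open>v\<close>.\<close>

lemma iterated_commutator:
  fixes v x :: "'a::ring_1"
  defines "\<delta> \<equiv> \<lambda>x. v * x - x * v"
  shows "(\<delta> ^^ n) x = (\<Sum>k\<le>n. of_int ((- 1) ^ k * int (n choose k)) * (v ^ (n - k) * x * v ^ k))"
proof (induction n)
  case (Suc n)
  define c where "c n k = (- 1) ^ k * int (n choose k)" for n k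
  define y where "y k l = v ^ k * x * v ^ l" for k l
  have scale: "z * (of_int i * u) = of_int i * (z * u)" for z u :: 'a and i
    by (simp only: mult.assoc[symmetric] mult_of_int_commute[of i z])
  have "(\<delta> ^^ Suc n) x = v * (\<Sum>k\<le>n. of_int (c n k) * y (n - k) k) - (\<Sum>k\<le>n. of_int (c n k) * y (n - k) k) * v"
    using Suc by (simp add: \<delta>_def c_def y_def)
  also have "v * (\<Sum>k\<le>n. of_int (c n k) * y (n - k) k) = (\<Sum>k\<le>n. of_int (c n k) * y (Suc n - k) k)"
    unfolding sum_distrib_left
    by (intro sum.cong refl) (simp add: scale y_def Suc_diff_le mult.assoc)
  also have "\<dots> = (\<Sum>k\<le>Suc n. of_int (c n k) * y (Suc n - k) k)"
    by (simp add: c_def binomial_eq_0)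
  also have "\<dots> = y (Suc n) 0 + (\<Sum>k\<le>n. of_int (c n (Suc k)) * y (n - k) (Suc k))"
    by (subst sum.atMost_Suc_shift) (simp add: c_def)
  also have "(\<Sum>k\<le>n. of_int (c n k) * y (n - k) k) * v = (\<Sum>k\<le>n. of_int (c n k) * y (n - k) (Suc k))"
    unfolding sum_distrib_right
    by (intro sum.cong refl) (simp add: y_def mult.assoc power_commutes)
  also have "y (Suc n) 0 + (\<Sum>k\<le>n. of_int (c n (Suc k)) * y (n - k) (Suc k))
      - (\<Sum>k\<le>n. of_int (c n k) * y (n - k) (Suc k))
      = y (Suc n) 0 + (\<Sum>k\<le>n. (of_int (c n (Suc k)) - of_int (c n k)) * y (n - k) (Suc k))"
    by (simp add: sum_subtractf left_diff_distrib)
  also have "(\<Sum>k\<le>n. (of_int (c n (Suc k)) - of_int (c n k)) * y (n - k) (Suc k))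
      = (\<Sum>k\<le>n. of_int (c (Suc n) (Suc k)) * y (n - k) (Suc k))"
    by (intro sum.cong refl arg_cong2[of _ _ _ _ "(*)"]) (simp add: c_def algebra_simps)
  also have "y (Suc n) 0 + \<dots> = (\<Sum>k\<le>Suc n. of_int (c (Suc n) k) * y (Suc n - k) k)"
    by (subst sum.atMost_Suc_shift) (simp add: c_def)
  finally show ?case by (simp add: c_def y_def)
qed simp

text \<open>The derivation \<open>\<delta> x = v x - x v\<close> satisfies \<open>\<delta>\<^sup>p = [v\<^sup>p, \<cdot>] = 0\<close>.  So there are \<open>w\<close> and \<open>c \<noteq> 0\<close> with
  \<open>\<delta> w = c\<close> and \<open>\<delta> c = 0\<close>, and \<open>y = c\<^sup>-\<^sup>1 w v\<close> satisfies \<open>\<delta> y = v\<close>.\<close>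

lemma inner_translation:
  fixes v :: "'a::division_ring"
  assumes p: "prime p" "of_nat p = (0 :: 'a)" and D: "division_subring D"
    and v: "v \<in> D" "v \<notin> relative_center D" "v ^ p \<in> relative_center D"
  shows "\<exists>y\<in>D. v * y = (y + 1) * v"
proof -
  define \<delta> where "\<delta> = (\<lambda>x. v * x - x * v)"
  note closed = division_subringD[OF D]
  obtain x where x: "x \<in> D" "\<delta> x \<noteq> 0" using v(1,2) by (auto simp: relative_center_def \<delta>_def)
  have D_iter: "(\<delta> ^^ n) x \<in> D" for n
    by (induction n) (auto simp: x(1) \<delta>_def intro!: closed v(1))
  obtain q where q: "p = Suc q" using prime_gt_0_nat[OF p(1)] by (cases p) auto
  have "(\<delta> ^^ p) x = (\<Sum>k\<le>p. of_int ((- 1) ^ k * int (p choose k)) * (v ^ (p - k) * x * v ^ k))"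
    unfolding \<delta>_def by (rule iterated_commutator)
  also have "{..p} = insert 0 (insert p {1..q})" using q by auto
  also have "(\<Sum>k\<in>insert 0 (insert p {1..q}). of_int ((- 1) ^ k * int (p choose k)) * (v ^ (p - k) * x * v ^ k))
      = v ^ p * x + (- 1) ^ p * (x * v ^ p)
        + (\<Sum>k\<in>{1..q}. of_int ((- 1) ^ k * int (p choose k)) * (v ^ (p - k) * x * v ^ k))"
    using q by simp
  also have "(\<Sum>k\<in>{1..q}. of_int ((- 1) ^ k * int (p choose k)) * (v ^ (p - k) * x * v ^ k)) = 0"
  proof (rule sum.neutral[OF ballI])
    fix k assume "k \<in> {1..q}"
    then have "p dvd (p choose k)" using q by (intro dvd_choose_prime p) auto
    then obtain l where "p choose k = p * l" by (rule dvdE)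
    then have "(of_nat (p choose k) :: 'a) = 0" using p(2) by simp
    then show "of_int ((- 1) ^ k * int (p choose k)) * (v ^ (p - k) * x * v ^ k) = 0" by simp
  qed
  also have "x * v ^ p = v ^ p * x" using relative_centerD[OF v(3) x(1)] by simp
  also have "v ^ p * x + (- 1) ^ p * (v ^ p * x) + 0 = 0"
  proof (cases "p = 2")
    case True
    have "v ^ p * x + v ^ p * x = of_nat 2 * (v ^ p * x)" by (simp only: of_nat_numeral mult_2)
    also have "\<dots> = 0" using p(2) True by simp
    finally show ?thesis using True by simp
  next
    case False
    then have "odd p" using p(1) prime_odd_nat[of p] prime_ge_2_nat[OF p(1)] by auto
    then show ?thesis by simp
  qed
  finally have "(\<delta> ^^ p) x = 0" .
  then obtain n where n: "(\<delta> ^^ n) x = 0" "\<And>k. k < n \<Longrightarrow> (\<delta> ^^ k) x \<noteq> 0"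
    using exists_least_iff[of "\<lambda>n. (\<delta> ^^ n) x = 0"] by blast
  have "x \<noteq> 0" using x(2) by (auto simp: \<delta>_def)
  have "n \<noteq> 0" using n(1) \<open>x \<noteq> 0\<close> by (intro notI) simp
  moreover have "n \<noteq> 1" using n(1) x(2) by (intro notI) simp
  ultimately obtain m where m: "n = Suc (Suc m)" by (metis One_nat_def not0_implies_Suc)
  define w c where "w = (\<delta> ^^ m) x" and "c = (\<delta> ^^ Suc m) x"
  have wD: "w \<in> D" and cD: "c \<in> D" unfolding w_def c_def by (rule D_iter)+
  have c0: "c \<noteq> 0" using n(2)[of "Suc m"] m by (simp add: c_def)
  have w: "v * w - w * v = c" by (simp add: w_def c_def \<delta>_def)
  have "v * c - c * v = 0" using n(1) m by (simp add: c_def \<delta>_def)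
  then have "inverse c * v = v * inverse c" by (intro commute_inverse) simp
  then have "v * (inverse c * w * v) = inverse c * (v * w) * v" by (simp add: mult.assoc[symmetric])
  also have "v * w = w * v + c" using w by (simp add: algebra_simps)
  also have "inverse c * (w * v + c) * v = (inverse c * w * v + 1) * v"
    using c0 by (simp add: distrib_left distrib_right mult.assoc[symmetric])
  finally have "v * (inverse c * w * v) = (inverse c * w * v + 1) * v" .
  moreover have "inverse c * w * v \<in> D" by (intro closed cD wD v(1))
  ultimately show ?thesis by blast
qed

text \<open>Put \<open>w = u + 1\<close>.  The commutator of \<open>v\<close> and \<open>u\<close> is \<open>r = w/(w - 1)\<close>, and conjugation by \<open>v\<close> takes it to
  \<open>r' = (w + 1)/w\<close>.  Since \<open>r\<^sup>m\<close> commutes with \<open>v\<close>, both have the same \<open>m\<close>-th power, so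
  \<open>r'/r = 1 - w\<^sup>-\<^sup>2\<close> is a root of unity, and \<open>w\<close> is algebraic over the prime field.\<close>

lemma translation_torsion:
  fixes u v :: "'a::division_ring"
  assumes p: "p > 0" "of_nat p = (0 :: 'a)" and vu: "v * u = (u + 1) * v" and "v \<noteq> 0"
    and m: "m > 0" "(v * u * inverse v * inverse u) ^ m * v = v * (v * u * inverse v * inverse u) ^ m"
  shows "torsion (u + 1)"
proof -
  define w where "w = u + 1"
  have u: "u = w - 1" by (simp add: w_def)

  have u0: "u \<noteq> 0" using vu \<open>v \<noteq> 0\<close> by auto
  have w0: "w \<noteq> 0"
  proof
    assume "w = 0"
    then have "v * u = 0" using vu by (simp add: w_def)
    then show False using u0 \<open>v \<noteq> 0\<close> by simp
  qed
  have vw: "v * w = (w + 1) * v" using vu by (simp add: w_def distrib_left distrib_right)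
  define r where "r = w * inverse u"
  have r: "v * u * inverse v * inverse u = r"
    using \<open>v \<noteq> 0\<close> by (simp add: r_def vu mult.assoc w_def)
  define r' where "r' = (w + 1) * inverse w"
  have "inverse (v * u * inverse v) = v * inverse u * inverse v"
    using \<open>v \<noteq> 0\<close> u0 by (simp add: nonzero_inverse_mult_distrib mult.assoc)
  moreover have "v * u * inverse v = w" using \<open>v \<noteq> 0\<close> by (simp add: vu mult.assoc w_def)
  ultimately have viv: "v * inverse u * inverse v = inverse w" by simp
  have "v * r * inverse v = (v * w) * inverse u * inverse v" by (simp add: r_def mult.assoc)
  also have "\<dots> = (w + 1) * (v * inverse u * inverse v)" by (simp add: vw mult.assoc)
  finally have "v * r * inverse v = r'" by (simp add: viv r'_def)
  then have "r' ^ m = v * r ^ m * inverse v" using conj_power[OF \<open>v \<noteq> 0\<close>, of r m] by simp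
  also have "\<dots> = r ^ m" using m(2) \<open>v \<noteq> 0\<close> unfolding r by (metis mult.assoc mult.right_neutral right_inverse)
  finally have rm: "r' ^ m = r ^ m" .
  have wu: "w * u = u * w" by (simp add: w_def algebra_simps)
  have iwu: "inverse w * u = u * inverse w" by (rule commute_inverse[OF wu])
  have ir: "inverse r = u * inverse w"
    using u0 w0 by (simp add: r_def nonzero_inverse_mult_distrib)
  have "r' * r = r * r'"
  proof -
    have uw: "inverse u * w = w * inverse u" by (rule commute_inverse[OF wu[symmetric]])
    have 1: "inverse u * inverse w = inverse w * inverse u"
      by (rule commute_inverse[OF iwu[symmetric]])
    have "r' * w = w * r'" by (simp add: r'_def distrib_right distrib_left mult.assoc w0)
    moreover have "r' * inverse u = inverse u * r'"
      by (simp add: r'_def distrib_right distrib_left mult.assoc 1[symmetric])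
        (simp add: mult.assoc[symmetric] uw)
    ultimately show ?thesis by (simp add: r_def mult.assoc[symmetric]) (simp add: mult.assoc)
  qed
  then have "r' * inverse r = inverse r * r'" by (metis commute_inverse)
  then have "(r' * inverse r) ^ m = r' ^ m * inverse r ^ m" by (rule power_mult_distrib_commute)
  also have "\<dots> = 1" using u0 w0 by (simp add: rm r_def power_inverse)
  finally have "torsion (r' * inverse r)" using m(1) by (auto simp: torsion_def)
  moreover have eta: "1 - r' * inverse r = inverse w * inverse w"
  proof -
    have "r' * inverse r = (w + 1) * (inverse w * u) * inverse w"
      by (simp add: r'_def ir mult.assoc)
    also have "\<dots> = (w + 1) * (w - 1) * (inverse w * inverse w)"
      unfolding iwu by (simp add: u mult.assoc)
    also have "(w + 1) * (w - 1) = w * w - 1" by (simp add: algebra_simps)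
    also have "(w * w - 1) * (inverse w * inverse w) = 1 - inverse w * inverse w"
    proof -
      have "w * w * (inverse w * inverse w) = w * (w * inverse w) * inverse w" by (simp only: mult.assoc)
      then show ?thesis using w0 by (simp add: left_diff_distrib)
    qed
    finally show ?thesis by simp
  qed
  moreover have "torsion (1 :: 'a)" by (auto simp: torsion_def intro: exI[of _ 1])
  moreover have "1 \<noteq> r' * inverse r"
  proof
    assume "1 = r' * inverse r"
    then have "inverse w * inverse w = 0" using eta by simp
    then show False using w0 by simp
  qed
  ultimately have "torsion (inverse w * inverse w)"
    using torsion_diff[OF p, of 1 "r' * inverse r"] by simp
  then obtain k where k: "k > 0" "(inverse w * inverse w) ^ k = 1" by (auto simp: torsion_def)
  have "inverse w ^ (2 * k) = 1" using k(2) by (simp add: power_mult power2_eq_square)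
  then have "inverse (w ^ (2 * k)) = inverse 1" by (simp add: power_inverse)
  then have "w ^ (2 * k) = 1" by (rule inverse_eq_imp_eq)
  then show ?thesis using k(1) unfolding torsion_def w_def by (intro exI[of _ "2 * k"]) simp
qed

text \<open>With \<open>y\<close>, every translate \<open>y + z\<close> by an element of the center is shifted by 1 under conjugation by
  \<open>v\<close>.  So \<open>y + 1\<close> and \<open>y + z + 1\<close> are both torsion, and \<open>z\<close> is their difference.\<close>

lemma inseparable_center_torsion:
  fixes v :: "'a::division_ring"
  assumes p: "prime p" "of_nat p = (0 :: 'a)" and D: "division_subring D"
    and v: "v \<in> D" "v \<notin> relative_center D" "v ^ p \<in> relative_center D"
    and radical: "\<And>u. u \<in> D \<Longrightarrow> u \<noteq> 0 \<Longrightarrow> \<exists>m>0. (v * u * inverse v * inverse u) ^ m \<in> relative_center D"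
    and z: "z \<in> relative_center D" "z \<noteq> 0"
  shows "torsion z"
proof -
  note closed = division_subringD[OF D]
  have p0: "p > 0" by (rule prime_gt_0_nat[OF p(1)])
  obtain y where y: "y \<in> D" "v * y = (y + 1) * v" using inner_translation[OF p D v] by blast
  have v0: "v \<noteq> 0" using v(2) division_subringD(1)[OF division_subring_relative_center[OF D]] by auto
  have tors: "torsion (u + 1)" if u: "u \<in> D" "v * u = (u + 1) * v" for u
  proof -
    have "u \<noteq> 0" using u(2) v0 by auto
    then obtain m where "m > 0" "(v * u * inverse v * inverse u) ^ m \<in> relative_center D"
      using radical[OF u(1)] by blast
    then show ?thesis
      using translation_torsion[OF p0 p(2) u(2) v0] relative_centerD[OF _ v(1)] by blast
  qed
  have zD: "z \<in> D" using z by (simp add: relative_center_def)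
  have "v * (y + z) = (y + z + 1) * v"
    using y(2) relative_centerD[OF z(1) v(1)] by (simp add: distrib_left distrib_right)
  then have 1: "torsion (y + z + 1)" using tors[of "y + z"] closed(3)[OF y(1) zD] by blast
  have 2: "torsion (y + 1)" using tors[OF y] .
  have "(y + z + 1) * (y + 1) = (y + 1) * (y + z + 1)"
    using relative_centerD[OF z(1) y(1)] by (simp add: algebra_simps)
  then have "torsion ((y + z + 1) - (y + 1))"
    using torsion_diff[OF p0 p(2) _ 1 2] z(2) by simp
  then show ?thesis by simp
qed

section \<open>Existence of suitable valuations\<close>

lemma valuation_above_3:
  assumes "\<And>n. n > 0 \<Longrightarrow> of_nat n \<noteq> (0 :: 'k::field)"
  shows "\<exists>A :: 'k set. unital_subring A \<and> of_nat 3 \<in> A \<and> inverse (of_nat 3) \<notin> A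
    \<and> (\<forall>x. x \<in> A \<or> inverse x \<in> A)"
proof (rule valuation_ring_exists[OF unital_subring_Ints])
  show "inverse (of_nat 3) \<notin> (\<int> :: 'k set)"
  proof
    assume "inverse (of_nat 3) \<in> (\<int> :: 'k set)"
    then obtain i where "inverse (of_nat 3 :: 'k) = of_int i" by (auto simp: Ints_def)
    then have "of_int (3 * i - 1) = (0 :: 'k)" using assms[of 3] by (simp add: field_simps)
    then have "of_int (abs (3 * i - 1)) = (0 :: 'k)" by (simp add: abs_if split: if_splits)
    then have "of_nat (nat (abs (3 * i - 1))) = (0 :: 'k)" by (simp add: of_nat_nat)
    moreover have "3 * i - 1 \<noteq> 0" by presburger
    then have "nat (abs (3 * i - 1)) > 0" by simp
    ultimately show False using assms by blast
  qed
qed simp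

text \<open>If \<open>1/t\<close> were an integer polynomial in \<open>t\<close>, then \<open>1/t\<close> would be integral over the prime field, hence
  torsion.\<close>

lemma valuation_above_nontorsion:
  fixes t :: "'k::field"
  assumes p: "p > 0" "of_nat p = (0 :: 'k)" and t: "t \<noteq> 0" "\<not> torsion t"
  shows "\<exists>A. unital_subring A \<and> t \<in> A \<and> inverse t \<notin> A \<and> (\<forall>x. x \<in> A \<or> inverse x \<in> A)"
proof (rule valuation_ring_exists[OF unital_subring_adjoin(1,3)[OF unital_subring_Ints]])
  show "inverse t \<notin> adjoin \<int> t"
  proof
    assume "inverse t \<in> adjoin \<int> t"
    then obtain f where f: "inverse t = poly f t" "\<And>i. Polynomial.coeff f i \<in> \<int>" by (auto simp: adjoin_def)
    define d where "d = Suc (degree f)"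
    define R :: "'k set" where "R = additive_span {1}"
    have 1: "1 \<in> R" unfolding R_def by (rule additive_span_base) auto
    have "of_nat n \<in> R" for n using additive_span_of_nat_mult[of 1 "{1 :: 'k}" n] 1 by (simp add: R_def)
    then have "of_int i \<in> R" for i
      using additive_span_uminus[OF p, of _ "{1}"] by (cases i) (auto simp: R_def simp del: of_nat_Suc)
    then have coeff: "Polynomial.coeff f i \<in> R" for i using f(2)[of i] by (auto simp: Ints_def)
    have "inverse t ^ d = poly f t * inverse t ^ degree f" by (simp add: d_def f(1)[symmetric])
    also have "\<dots> = (\<Sum>i<d. Polynomial.coeff f i * t ^ i * inverse t ^ degree f)"
      by (simp add: poly_altdef sum_distrib_right d_def lessThan_Suc_atMost)
    also have "\<dots> = (\<Sum>i<d. Polynomial.coeff f i * inverse t ^ (degree f - i))"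
    proof (rule sum.cong[OF refl])
      fix i assume "i \<in> {..<d}"
      then have "inverse t ^ degree f = inverse t ^ i * inverse t ^ (degree f - i)"
        by (simp add: d_def flip: power_add)
      then show "Polynomial.coeff f i * t ^ i * inverse t ^ degree f = Polynomial.coeff f i * inverse t ^ (degree f - i)"
        using t(1) by (simp add: power_inverse)
    qed
    also have "\<dots> = (\<Sum>i<d. Polynomial.coeff f (degree f - i) * inverse t ^ i)"
      unfolding d_def by (subst sum.nat_diff_reindex[symmetric]) (intro sum.cong refl, simp)
    finally have eq: "inverse t ^ d = (\<Sum>i<d. Polynomial.coeff f (degree f - i) * inverse t ^ i)" .
    have "torsion (inverse t)"
    proof (rule torsion_integral[OF _ _ 1 _ _ coeff eq])
      show "finite R" unfolding R_def by (rule finite_additive_span[OF p]) simp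
      show "0 \<in> R" unfolding R_def by (rule additive_span_0)
      show "r + s \<in> R \<and> r * s \<in> R" if "r \<in> R" "s \<in> R" for r s
        using that additive_span_add[of r "{1}" s] additive_span_mult[of "{1}" r s] by (simp add: R_def)
    qed (use t in \<open>auto simp: mult.commute\<close>)
    then show False using t(2) by (simp add: torsion_def power_inverse)
  qed
qed

lemma (in center_lattice) tame_coprime:
  assumes "q * i = n * j + 1" and n: "of_nat n = (0 :: 'a center) \<or> of_nat n = t"
  shows "tame q"
proof -
  have iA: "of_nat i \<in> A" and jA: "of_nat j \<in> A" for i j
    using A_closed(8)[of "int i"] A_closed(8)[of "int j"] by auto
  have eq: "of_nat q * of_nat i = of_nat n * of_nat j + (1 :: 'a center)"
    using assms(1) by (metis of_nat_1 of_nat_add of_nat_mult)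
  from n show ?thesis
  proof
    assume "of_nat n = (0 :: 'a center)"
    then have *: "of_nat q * of_nat i = (1 :: 'a center)" using eq by simp
    then have "inverse (of_nat q) \<in> A" using iA inverse_unique by metis
    moreover have "of_nat q \<noteq> (0 :: 'a center)" using * by auto
    ultimately show ?thesis by (rule tame_unit)
  next
    assume "of_nat n = t"
    then have *: "of_nat q * of_nat i = 1 + t * of_nat j" using eq by (simp add: add.commute)
    note unit = valuation_unit[OF A_ring A_valuation t jA[of j]]
    have "of_nat q * (of_nat i * inverse (1 + t * of_nat j)) = 1"
      using unit(1) * by (simp add: mult.assoc[symmetric])
    then have "inverse (of_nat q) \<in> A"
      using inverse_unique A_closed(6)[OF iA[of i] unit(2)] by metis
    moreover have "of_nat q \<noteq> (0 :: 'a center)" using * unit(1) by auto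
    ultimately show ?thesis by (rule tame_unit)
  qed
qed

section \<open>Torsion centers\<close>

lemma in_span_of_sequence:
  fixes f :: "nat \<Rightarrow> 'a::division_ring"
  assumes "y \<in> center_space.span (f ` {..<d})"
  shows "\<exists>c. y = (\<Sum>i<d. c i \<cdot> f i)"
proof -
  define V where "V = {y. \<exists>c. y = (\<Sum>i<d. c i \<cdot> f i)}"
  have "center_space.subspace V"
  proof (rule center_space.subspaceI)
    show "0 \<in> V" unfolding V_def by (intro CollectI exI[of _ "\<lambda>_. 0"]) simp
    show "x + y \<in> V" if xy: "x \<in> V" "y \<in> V" for x y
    proof -
      obtain c e where "x = (\<Sum>i<d. c i \<cdot> f i)" "y = (\<Sum>i<d. e i \<cdot> f i)" using xy by (auto simp: V_def)
      then have "x + y = (\<Sum>i<d. (c i + e i) \<cdot> f i)"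
        by (simp add: sum.distrib center_space.scale_left_distrib)
      then show ?thesis unfolding V_def by (intro CollectI exI[of _ "\<lambda>i. c i + e i"])
    qed
    show "a \<cdot> x \<in> V" if x: "x \<in> V" for a x
    proof -
      obtain c where "x = (\<Sum>i<d. c i \<cdot> f i)" using x by (auto simp: V_def)
      then have "a \<cdot> x = (\<Sum>i<d. (a * c i) \<cdot> f i)" by (simp add: center_space.scale_sum_right)
      then show ?thesis unfolding V_def by (intro CollectI exI[of _ "\<lambda>i. a * c i"])
    qed
  qed
  moreover have "f ` {..<d} \<subseteq> V"
  proof
    fix y assume "y \<in> f ` {..<d}"
    then obtain j where j: "j < d" "y = f j" by auto
    have "(\<Sum>i<d. (if i = j then 1 else 0) \<cdot> f i) = (\<Sum>i<d. if i = j then f j else 0)"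
      by (intro sum.cong refl) auto
    then show "y \<in> V" unfolding V_def using j by (intro CollectI exI[of _ "\<lambda>i. if i = j then 1 else 0"]) simp
  qed
  ultimately have "center_space.span (f ` {..<d}) \<subseteq> V" by (rule center_space.span_minimal[rotated])
  then show ?thesis using assms by (auto simp: V_def)
qed

text \<open>By finite dimension some power of \<open>x\<close> is a combination of lower powers; the finitely many
  coefficients generate a finite ring, over which \<open>x\<close> is integral.\<close>

lemma torsion_over_torsion_center:
  fixes D :: "'a::division_ring set"
  assumes p: "p > 0" "of_nat p = (0 :: 'a)" and D: "division_subring D" "finite_dimensional_over_center D"
    and tors: "\<And>z :: 'a. z \<in> ring_center \<Longrightarrow> z \<noteq> 0 \<Longrightarrow> torsion z" and x: "x \<in> D" "x \<noteq> 0"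
  shows "torsion x"
proof -
  obtain B where B: "finite B" "D = center_space.span B"
    using D(2) unfolding finite_dimensional_over_center_def by blast
  define S where "S d = (\<lambda>i. x ^ i) ` {..<d}" for d :: nat
  have "\<exists>d. x ^ d \<in> center_space.span (S d)"
  proof (rule ccontr)
    assume contra: "\<not> ?thesis"
    have ind: "center_space.independent (S n) \<and> card (S n) = n" for n
    proof (induction n)
      case (Suc n)
      have S: "S (Suc n) = insert (x ^ n) (S n)" by (simp add: S_def lessThan_Suc)
      have notin: "x ^ n \<notin> center_space.span (S n)" using contra by blast
      then have "x ^ n \<notin> S n" using center_space.span_base by blast
      moreover have "finite (S n)" by (simp add: S_def)
      ultimately show ?case
        using Suc notin by (simp add: S center_space.independent_insertI)
    qed (simp add: S_def center_space.independent_empty)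
    have "S (Suc (card B)) \<subseteq> center_space.span B"
      using division_subringD(8)[OF D(1) x(1)] by (auto simp: S_def B(2)[symmetric])
    then show False
      using center_space.independent_span_bound[OF B(1), of "S (Suc (card B))"] ind[of "Suc (card B)"] by simp
  qed
  then obtain d where "x ^ d \<in> center_space.span ((\<lambda>i. x ^ i) ` {..<d})" by (auto simp: S_def)
  from in_span_of_sequence[OF this] obtain c where c: "x ^ d = (\<Sum>i<d. c i \<cdot> x ^ i)" by blast
  define C where "C = (\<lambda>i. of_center (c i)) ` {..<d}"
  have C: "finite C" "C \<subseteq> ring_center" using of_center by (auto simp: C_def)
  have "torsion z" if z: "z \<in> C" "z \<noteq> 0" for z using tors z C(2) by blast
  note C_torsion = this
  from finite_ring_of_torsion[OF p C C_torsion] obtain R :: "'a set"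
    where R: "finite R" "C \<subseteq> R" "R \<subseteq> ring_center"
      "0 \<in> R" "1 \<in> R" "\<forall>r\<in>R. \<forall>s\<in>R. r + s \<in> R \<and> r * s \<in> R"
    by auto
  define e where "e i = (if i < d then of_center (c i) else 0)" for i
  have "e i \<in> R" for i using R(2,4) by (auto simp: e_def C_def)
  moreover have "x ^ d = (\<Sum>i<d. e i * x ^ i)" unfolding c by (simp add: e_def center_scale_def)
  moreover have "r * x = x * r" if "r \<in> R" for r using R(3) that ring_centerD by blast
  moreover have "r + s \<in> R \<and> r * s \<in> R" if "r \<in> R" "s \<in> R" for r s using R(6) that by simp
  ultimately show ?thesis using torsion_integral[OF R(1,4,5), of x e d] x(2) by simp
qed

section \<open>Normal subgroups radical over a division subring\<close>

lemma normal_subgroup_mult_group: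
  fixes N :: "'a::division_ring set"
  assumes "N \<lhd> mult_group"
  shows "0 \<notin> N" "x \<in> N \<Longrightarrow> y \<in> N \<Longrightarrow> x * y \<in> N" "x \<in> N \<Longrightarrow> inverse x \<in> N"
    "z \<noteq> 0 \<Longrightarrow> x \<in> N \<Longrightarrow> z * x * inverse z \<in> N"
proof -
  interpret normal N mult_group by (rule assms)
  have inv: "inv\<^bsub>mult_group\<^esub> z = inverse z" if "z \<noteq> 0" for z :: 'a
    using that by (intro inv_equality) (auto simp: mult_group_def)
  have nz: "x \<noteq> 0" if "x \<in> N" for x using subset that by (auto simp: mult_group_def)
  then show "0 \<notin> N" by blast
  show "x \<in> N \<Longrightarrow> y \<in> N \<Longrightarrow> x * y \<in> N"     using subgroup.m_closed[OF subgroup_axioms, of x y] by (simp add: mult_group_def)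
  show "x \<in> N \<Longrightarrow> inverse x \<in> N"     using subgroup.m_inv_closed[OF subgroup_axioms, of x] inv nz by simp
  show "z \<noteq> 0 \<Longrightarrow> x \<in> N \<Longrightarrow> z * x * inverse z \<in> N"
    using inv_op_closed2[of z x] inv by (simp add: mult_group_def)
qed

text \<open>For \<open>x \<notin> K\<close> choose \<open>n\<close> such that \<open>A = a\<^sup>n\<close>, \<open>B = x A x\<^sup>-\<^sup>1\<close> and \<open>C = (1 + x) A (1 + x)\<^sup>-\<^sup>1\<close> are all in \<open>K\<close>.
  Then \<open>(C - B) x = A - C\<close> forces \<open>A = B = C\<close>.  An \<open>x \<in> K\<close> is the difference of two elements outside
  \<open>K\<close>.\<close>

lemma radical_power_commutes:
  fixes N K :: "'a::division_ring set"
  assumes N: "N \<lhd> mult_group" and K: "division_subring K" "K \<noteq> UNIV" "radical_over N K"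
    and a: "a \<in> N"
  shows "\<exists>n>0. a ^ n * x = x * a ^ n"
proof -
  note NN = normal_subgroup_mult_group[OF N] and KD = division_subringD[OF K(1)]
  have outside: "\<exists>n>0. a ^ n * x = x * a ^ n" if x: "x \<notin> K" for x
  proof -
    have x0: "x \<noteq> 0" using KD(1) x by auto
    have x1: "1 + x \<noteq> 0" using KD(5)[OF KD(2)] x by (metis add_eq_0_iff)
    have K_power: "\<exists>n>0. y ^ n \<in> K" if "y \<in> N" for y using K(3) that by (auto simp: radical_over_def)
    obtain i where i: "i > 0" "a ^ i \<in> K" using K_power[OF a] by blast
    obtain j where j: "j > 0" "(x * a * inverse x) ^ j \<in> K" using K_power[OF NN(4)[OF x0 a]] by blast
    obtain k where k: "k > 0" "((1 + x) * a * inverse (1 + x)) ^ k \<in> K"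
      using K_power[OF NN(4)[OF x1 a]] by blast
    define n where "n = i * j * k"
    have n: "n = i * (j * k)" "n = j * (i * k)" "n = k * (i * j)" by (simp_all add: n_def)
    define A B C where "A = a ^ n" and "B = x * A * inverse x" and "C = (1 + x) * A * inverse (1 + x)"
    have "A \<in> K" unfolding A_def n(1) power_mult by (intro KD(8) i(2))
    have "B \<in> K" unfolding B_def A_def conj_power[OF x0, symmetric] n(2) power_mult by (intro KD(8) j(2))
    have "C \<in> K" unfolding C_def A_def conj_power[OF x1, symmetric] n(3) power_mult by (intro KD(8) k(2))
    have B: "B * x = x * A" using x0 by (simp add: B_def mult.assoc)
    have C: "C * (1 + x) = (1 + x) * A" using x1 by (simp add: C_def mult.assoc)
    have eq: "(C - B) * x = A - C" using B C by (simp add: algebra_simps)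
    have "C = B"
    proof (rule ccontr)
      assume "C \<noteq> B"
      then have "C - B \<noteq> 0" by simp
      then have "x = inverse (C - B) * ((C - B) * x)" by (simp flip: mult.assoc)
      also have "\<dots> \<in> K" unfolding eq by (intro KD \<open>A \<in> K\<close> \<open>B \<in> K\<close> \<open>C \<in> K\<close>)
      finally show False using x by simp
    qed
    then have "B = A" using eq by simp
    then have "a ^ n * x = x * a ^ n" using B by (simp add: A_def)
    moreover have "n > 0" using i j k by (simp add: n_def)
    ultimately show ?thesis by blast
  qed
  show ?thesis
  proof (cases "x \<in> K")
    case True
    obtain y where y: "y \<notin> K" using K(2) by blast
    have "x + y \<notin> K" using KD(4)[of "x + y" x] True y by auto
    then obtain m n where m: "m > 0" "a ^ m * y = y * a ^ m" and n: "n > 0" "a ^ n * (x + y) = (x + y) * a ^ n"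
      using outside y by blast
    have "a ^ (m * n) * y = y * a ^ (m * n)" unfolding power_mult by (rule commute_power[OF m(2)])
    moreover have "a ^ (m * n) * (x + y) = (x + y) * a ^ (m * n)"
      unfolding mult.commute[of m n] power_mult by (rule commute_power[OF n(2)])
    ultimately have "a ^ (m * n) * x = x * a ^ (m * n)" by (simp add: distrib_left distrib_right)
    then show ?thesis using m(1) n(1) by (intro exI[of _ "m * n"]) simp
  qed (rule outside)
qed

lemma radical_over_relative_center:
  fixes N K :: "'a::division_ring set"
  assumes N: "N \<lhd> mult_group" and K: "division_subring K" "K \<noteq> UNIV" "radical_over N K"
    and D: "division_subring D" "finite_dimensional_over_center D" and a: "a \<in> N" "a \<in> D"
  shows "\<exists>n>0. a ^ n \<in> relative_center D"
proof -
  obtain B where B: "finite B" "D = center_space.span B"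
    using D(2) unfolding finite_dimensional_over_center_def by blast
  have "\<exists>n>0. \<forall>b\<in>B. a ^ n * b = b * a ^ n"
    using B(1)
  proof (induction B)
    case (insert b B)
    then obtain m where m: "m > 0" "\<And>b. b \<in> B \<Longrightarrow> a ^ m * b = b * a ^ m" by blast
    obtain n where n: "n > 0" "a ^ n * b = b * a ^ n" using radical_power_commutes[OF N K a(1)] by blast
    have "a ^ (m * n) * c = c * a ^ (m * n)" if "c \<in> insert b B" for c
    proof (cases "c = b")
      case True
      show ?thesis unfolding True mult.commute[of m n] power_mult by (rule commute_power[OF n(2)])
    next
      case False
      then have "c \<in> B" using that by simp
      then show ?thesis unfolding power_mult by (intro commute_power m(2))
    qed
    then show ?case using m(1) n(1) by (intro exI[of _ "m * n"]) simp
  qed (auto intro: exI[of _ 1])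
  then obtain n where n: "n > 0" "\<And>b. b \<in> B \<Longrightarrow> a ^ n * b = b * a ^ n" by blast
  have "center_space.subspace {x. a ^ n * x = x * a ^ n}"
    by (rule center_space.subspaceI) (simp_all add: distrib_left distrib_right scale_mult_left scale_mult_right)
  moreover have "B \<subseteq> {x. a ^ n * x = x * a ^ n}" using n(2) by blast
  ultimately have "D \<subseteq> {x. a ^ n * x = x * a ^ n}"
    unfolding B(2) by (rule center_space.span_minimal[rotated])
  moreover have "a ^ n \<in> D" by (rule division_subringD(8)[OF D(1) a(2)])
  ultimately have "a ^ n \<in> relative_center D" by (auto simp: relative_center_def)
  then show ?thesis using n(1) by blast
qed

theorem corollary3p5:
  fixes N K :: "'a::division_ring set"
  assumes "\<exists>x y :: 'a. x * y \<noteq> y * x"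
    and "locally_finite TYPE('a)"
    and "N \<lhd> mult_group"
    and "division_subring K" and "K \<noteq> UNIV"
    and "radical_over N K"
  shows "N \<subseteq> ring_center"
proof (rule ccontr)
  assume "\<not> N \<subseteq> ring_center"
  then obtain a b where a: "a \<in> N" and ab: "a * b \<noteq> b * a" by (auto simp: ring_center_def)
  define D where "D = division_subring hull (ring_center \<union> {a, b})"
  have D: "division_subring D" unfolding D_def by (rule division_subring_hull)
  have sub: "ring_center \<union> {a, b} \<subseteq> D" unfolding D_def by (rule hull_subset)
  then have FD: "ring_center \<subseteq> D" and aD: "a \<in> D" and bD: "b \<in> D" by auto
  have fin: "finite_dimensional_over_center D"
    using assms(2)[unfolded locally_finite_def, rule_format, of "{a, b}"] by (simp add: D_def)
  define Z where "Z = relative_center D"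
  note N = normal_subgroup_mult_group[OF assms(3)]
  note closed = division_subringD[OF D]
  have radical: "\<exists>n>0. u ^ n \<in> Z" if "u \<in> N" "u \<in> D" for u
    unfolding Z_def by (rule radical_over_relative_center[OF assms(3-6) D fin that])
  have aZ: "a \<notin> Z" using ab bD by (auto simp: Z_def relative_center_def)
  have N_power: "u ^ k \<in> N" if "u \<in> N" "u ^ k \<notin> Z" for u k
    using that(2)
  proof (induction k)
    case 0
    then show ?case using division_subringD(2)[OF division_subring_relative_center[OF D]] by (simp add: Z_def)
  next
    case (Suc k)
    show ?case
      by (induction k) (auto intro: N(2) that(1))
  qed
  \<comment> \<open>Every valuation yields a noncentral element of \<open>N\<close> whose \<open>q\<close>-th power is central, for a
    prime \<open>q\<close> outside the range of the dominance argument.\<close>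
  have wild: "\<exists>v q. v \<in> N \<and> v \<in> D \<and> v \<notin> Z \<and> v ^ q \<in> Z \<and> prime q \<and> \<not> center_lattice.tame A t q"
    if "center_lattice D I J \<psi> A t" for I J :: "'a set" and \<psi> A t
  proof -
    interpret center_lattice D I J \<psi> A t by (rule that)
    obtain x where x: "x \<in> D" "x \<noteq> 0" "x * a * inverse x * inverse a \<notin> Z"
        "x * a * inverse x * inverse a - 1 \<in> infinitesimal"
      using noncentral_commutator_near_1[OF aD] aZ unfolding Z_def by blast
    define v where "v = x * a * inverse x * inverse a"
    have v: "v \<in> D" "v \<in> N" unfolding v_def by (auto intro!: closed N x aD a)
    obtain m where m: "m > 0" "v ^ m \<in> Z" using radical[OF v(2,1)] by blast
    obtain q k where "prime q" "\<not> tame q" "v ^ k \<notin> Z" "(v ^ k) ^ q \<in> Z"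
      using radical_near_1_wild[OF v(1)] x(3,4) m unfolding v_def Z_def by blast
    then show ?thesis using N_power[OF v(2)] closed(8)[OF v(1)] by blast
  qed
  have of_nat_0: "of_nat n = (0 :: 'a center) \<longleftrightarrow> of_nat n = (0 :: 'a)" for n
    using of_center_inject[of "of_nat n :: 'a center" 0]
    unfolding of_center_of_nat of_center_ops(3) by (rule sym)
  show False
  proof (cases "\<forall>n>0. of_nat n \<noteq> (0 :: 'a)")
    case True
    obtain A :: "'a center set" where A: "unital_subring A" "of_nat 3 \<in> A" "inverse (of_nat 3) \<notin> A"
        "\<And>x. x \<in> A \<or> inverse x \<in> A"
      using valuation_above_3 True of_nat_0 by metis
    obtain I J and \<psi> :: "'a \<Rightarrow> 'a \<Rightarrow> 'a center" where L: "center_lattice D I J \<psi> A (of_nat 3)"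
      using center_lattice_exists[OF D FD fin A(1,4,2,3)] by blast
    interpret center_lattice D I J \<psi> A "of_nat 3" by (rule L)
    obtain q where q: "prime q" "\<not> tame q" using wild[OF L] by blast
    have "q \<noteq> 3" using q(2) tame_3 by auto
    then have "coprime q 3" using q(1) by (simp add: primes_coprime)
    then obtain i j where "q * i = 3 * j + 1"
      using bezout_nat[of q 3] prime_gt_0_nat[OF q(1)] by auto
    then show False using tame_coprime[of q i 3 j] q(2) by simp
  next
    case False
    then obtain p where p: "prime p" "of_nat p = (0 :: 'a)" using prime_characteristic by blast
    have p0: "p > 0" by (rule prime_gt_0_nat[OF p(1)])
    have p': "of_nat p = (0 :: 'a center)" using p(2) of_nat_0 by blast
    have torsion_center: "torsion z" if z: "z \<in> ring_center" "z \<noteq> 0" for z :: 'a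
    proof (rule ccontr)
      assume nt: "\<not> torsion z"
      obtain t where t: "z = of_center t" using z(1) by (metis to_center_inverse)
      have t0: "t \<noteq> 0" using z(2) t by (auto simp: of_center_ops)
      have nt': "\<not> torsion t"
      proof
        assume "torsion t"
        then obtain n where n: "n > 0" "t ^ n = 1" by (auto simp: torsion_def)
        then have "z ^ n = 1" unfolding t of_center_power[symmetric] by (simp add: of_center_ops)
        then show False using nt n(1) unfolding torsion_def by blast
      qed
      from valuation_above_nontorsion[OF p0 p' t0 nt']
      obtain A where A: "unital_subring A" "t \<in> A" "inverse t \<notin> A" "\<And>x. x \<in> A \<or> inverse x \<in> A"
        by blast
      obtain I J and \<psi> :: "'a \<Rightarrow> 'a \<Rightarrow> 'a center" where L: "center_lattice D I J \<psi> A t"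
        using center_lattice_exists[OF D FD fin A(1,4,2,3)] by blast
      interpret center_lattice D I J \<psi> A t by (rule L)
      obtain v q where v: "v \<in> N" "v \<in> D" "v \<notin> Z" "v ^ q \<in> Z" and q: "prime q" "\<not> tame q"
        using wild[OF L] by blast
      have "q = p"
      proof (rule ccontr)
        assume "q \<noteq> p"
        then have "coprime q p" using q(1) p(1) by (simp add: primes_coprime)
        then obtain i j where "q * i = p * j + 1"
          using bezout_nat[of q p] prime_gt_0_nat[OF q(1)] by auto
        then show False using tame_coprime[of q i p j] q(2) p' by simp
      qed
      then have vp: "v ^ p \<in> relative_center D" using v(4) by (simp add: Z_def)
      have "torsion z"
      proof (rule inseparable_center_torsion[OF p D v(2) v(3)[unfolded Z_def] vp])
        fix u assume u: "u \<in> D" "u \<noteq> 0"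
        have "v * (u * inverse v * inverse u) \<in> N" by (intro N v u)
        then have "v * u * inverse v * inverse u \<in> N" by (simp add: mult.assoc)
        moreover have "v * u * inverse v * inverse u \<in> D" by (intro closed v u)
        ultimately show "\<exists>m>0. (v * u * inverse v * inverse u) ^ m \<in> relative_center D"
          using radical unfolding Z_def by blast
      next
        show "z \<in> relative_center D" using z(1) ring_center_subset_relative_center[OF FD] by blast
      qed (rule z(2))
      then show False using nt by simp
    qed
    have "a * b = b * a"
      using jacobson_torsion_commutative[OF p D _ aD bD]
        torsion_over_torsion_center[OF p0 p(2) D fin torsion_center] by blast
    then show False using ab by simp
  qed
qed

end
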